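(* Let $G$ be one of the following uniform coloured graphs: the cycle $C_n$ ($n\ge3$), the complete graph $K_n$ ($n\ge2$), the complete bipartite graph $K_{m,m}$ ($m\ge2$), or the hyperoctahedral graph $H_m$ ($m\ge2$), with associated linear space $\mathcal L$, and let $L$ be the vector space of linear forms in $I(\mathcal L^{-1})$. Then $L$ is spanned by linear forms induced by symmetries of $G$, and $r=s$. More precisely: 1. If $G=C_n$ (vertices $1,\dots,n$, edges $\{i,i+1\}$ mod $n$), then $r=s=\lfloor n/2\rfloor+1$ and $L$ is spanned by $x_{1,1+d}-x_{i,i+d}$ for $i=2,\dots,n$, $d=0,\dots,\lfloor n/2\rfloor$, indices taken modulo $n$ (in $\{1,\dots,n\}$) and $x_{ji}:=x_{ij}$. 2. If $G=K_n$, then $r=s=2$ and $L$ is spanned by $x_{11}-x_{ii}$ ($i\in V$) and $x_{12}-x_{ij}$ ($\{i,j\}\in E$). 3. If $G=K_{m,m}$ on vertices $1,\dots,2m$ whose two parts are the odd and the even vertices, then $r=s=3$ and $L$ is spanned by $x_{11}-x_{ii}$ ($i\in V$), $x_{12}-x_{ij}$ ($\{i,j\}\in E$), and $x_{13}-x_{ij}$ ($\{i,j\}\in E^c$). 4. If $G=H_m$, the graph on $1,\dots,2m$ obtained from $K_{2m}$ by removing the edges $\{2k-1,2k\}$, $k=1,\dots,m$, then $r=s=3$ and $L$ is spanned by $x_{11}-x_{ii}$ ($i\in V$), $x_{13}-x_{ij}$ ($\{i,j\}\in E$), and $x_{12}-x_{ij}$ ($\{i,j\}\in E^c$).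
   Context: Let $G=(V,E)$ be a simple undirected graph, $V=\{1,\dots,n\}$, with $E^c$ the set of non-edges (pairs of distinct vertices not joined by an edge). Its uniform coloured version has one vertex colour and one edge colour; its associated linear space is $\mathcal L=\{\lambda_1 I_n+\lambda_2A_2:\lambda_1,\lambda_2\in\mathbb C\}\subseteq\mathbb S^n$ where $A_2$ is the (0/1) adjacency matrix of $G$. The reciprocal variety $\mathcal L^{-1}$ is the Zariski closure of $\{M^{-1}:M\in\mathcal L\text{ invertible}\}$, with vanishing ideal $I(\mathcal L^{-1})\subseteq\mathbb C[x_{ij}:1\le i\le j\le n]$, using $x_{ji}=x_{ij}$ and $X=(x_{ij})$. A symmetry of $G$ is a permutation matrix $B$ with $BA_2B^{-1}=A_2$ (a graph automorphism); linear forms induced by symmetries are the entries of $BXB^{-1}-X$ over all symmetries $B$. Here $r$ is the number of distinct eigenvalues of $A_2$, and $s$ is the number of orbits of the automorphism group $\operatorname{Aut}(G)$ acting on the set of unordered pairs $\{i,j\}$ of (not necessarily distinct) vertices via $\{i,j\}\mapsto\{\sigma(i),\sigma(j)\}$. *)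

theory Defs
  imports Complex_Main "HOL-Combinatorics.Permutations"
begin

text \<open>Graphs on vertex set {1..n}, given by a symmetric irreflexive edge relation E.
  Matrices are functions nat => nat => complex, only entries in {1..n} matter.
  A linear form in the variables x_ij (i <= j) is a coefficient function on
  index pairs (i,j) with 1 <= i <= j <= n.\<close>

definition Pairs :: "nat \<Rightarrow> (nat \<times> nat) set" where
  "Pairs n = {(i,j). 1 \<le> i \<and> i \<le> j \<and> j \<le> n}"

definition var :: "nat \<Rightarrow> nat \<Rightarrow> (nat \<times> nat \<Rightarrow> complex)" where
  "var i j = (\<lambda>p. if p = (min i j, max i j) then 1 else 0)"

definition lf_eval :: "nat \<Rightarrow> (nat \<times> nat \<Rightarrow> complex) \<Rightarrow> (nat \<Rightarrow> nat \<Rightarrow> complex) \<Rightarrow> complex" where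
  "lf_eval n c X = (\<Sum>p\<in>Pairs n. c p * X (fst p) (snd p))"

definition lspan :: "(nat \<times> nat \<Rightarrow> complex) set \<Rightarrow> (nat \<times> nat \<Rightarrow> complex) set" where
  "lspan S = {f. \<exists>T c. finite T \<and> T \<subseteq> S \<and> f = (\<lambda>p. \<Sum>g\<in>T. c g * g p)}"

definition matmul :: "nat \<Rightarrow> (nat \<Rightarrow> nat \<Rightarrow> complex) \<Rightarrow> (nat \<Rightarrow> nat \<Rightarrow> complex) \<Rightarrow> nat \<Rightarrow> nat \<Rightarrow> complex" where
  "matmul n M N i j = (\<Sum>k\<in>{1..n}. M i k * N k j)"

definition is_inv :: "nat \<Rightarrow> (nat \<Rightarrow> nat \<Rightarrow> complex) \<Rightarrow> (nat \<Rightarrow> nat \<Rightarrow> complex) \<Rightarrow> bool" where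
  "is_inv n M N \<longleftrightarrow> (\<forall>i\<in>{1..n}. \<forall>j\<in>{1..n}.
      matmul n M N i j = (if i = j then 1 else 0) \<and> matmul n N M i j = (if i = j then 1 else 0))"

definition adj :: "(nat \<Rightarrow> nat \<Rightarrow> bool) \<Rightarrow> nat \<Rightarrow> nat \<Rightarrow> complex" where
  "adj E i j = (if E i j then 1 else 0)"

definition Lmat :: "(nat \<Rightarrow> nat \<Rightarrow> bool) \<Rightarrow> complex \<Rightarrow> complex \<Rightarrow> nat \<Rightarrow> nat \<Rightarrow> complex" where
  "Lmat E l1 l2 i j = l1 * (if i = j then 1 else 0) + l2 * adj E i j"

text \<open>Linear forms in the vanishing ideal of the reciprocal variety: homogeneous linear
  forms vanishing on all inverses of invertible matrices of the linear space (a polynomial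
  vanishes on a Zariski closure iff it vanishes on the set).\<close>
definition lin_forms :: "nat \<Rightarrow> (nat \<Rightarrow> nat \<Rightarrow> bool) \<Rightarrow> (nat \<times> nat \<Rightarrow> complex) set" where
  "lin_forms n E = {c. (\<forall>p. p \<notin> Pairs n \<longrightarrow> c p = 0) \<and>
      (\<forall>l1 l2 N. is_inv n (Lmat E l1 l2) N \<longrightarrow> lf_eval n c N = 0)}"

text \<open>Graph automorphisms (permutation matrices commuting with A_2).\<close>
definition aut :: "nat \<Rightarrow> (nat \<Rightarrow> nat \<Rightarrow> bool) \<Rightarrow> (nat \<Rightarrow> nat) set" where
  "aut n E = {\<sigma>. \<sigma> permutes {1..n} \<and> (\<forall>i\<in>{1..n}. \<forall>j\<in>{1..n}. E (\<sigma> i) (\<sigma> j) = E i j)}"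

text \<open>Entries of B X B^{-1} - X: for B the permutation matrix of sigma, the (i,j) entry of
  B X B^{-1} is x_{sigma^{-1} i, sigma^{-1} j}.\<close>
definition sym_forms :: "nat \<Rightarrow> (nat \<Rightarrow> nat \<Rightarrow> bool) \<Rightarrow> (nat \<times> nat \<Rightarrow> complex) set" where
  "sym_forms n E = {(\<lambda>p. var (inv \<sigma> i) (inv \<sigma> j) p - var i j p) | \<sigma> i j.
      \<sigma> \<in> aut n E \<and> i \<in> {1..n} \<and> j \<in> {1..n}}"

definition num_eigs :: "nat \<Rightarrow> (nat \<Rightarrow> nat \<Rightarrow> bool) \<Rightarrow> nat" where
  "num_eigs n E = card {\<mu>. \<exists>v. (\<exists>i\<in>{1..n}. v i \<noteq> 0) \<and>
      (\<forall>i\<in>{1..n}. (\<Sum>j\<in>{1..n}. adj E i j * v j) = \<mu> * v i)}"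

definition upairs :: "nat \<Rightarrow> nat set set" where
  "upairs n = {{i, j} | i j. i \<in> {1..n} \<and> j \<in> {1..n}}"

definition num_orbits :: "nat \<Rightarrow> (nat \<Rightarrow> nat \<Rightarrow> bool) \<Rightarrow> nat" where
  "num_orbits n E = card {{\<sigma> ` p | \<sigma>. \<sigma> \<in> aut n E} | p. p \<in> upairs n}"

definition cycle_graph :: "nat \<Rightarrow> nat \<Rightarrow> nat \<Rightarrow> bool" where
  "cycle_graph n i j \<longleftrightarrow> i \<in> {1..n} \<and> j \<in> {1..n} \<and> i \<noteq> j \<and>
      (j = i mod n + 1 \<or> i = j mod n + 1)"

definition complete_graph :: "nat \<Rightarrow> nat \<Rightarrow> nat \<Rightarrow> bool" where
  "complete_graph n i j \<longleftrightarrow> i \<in> {1..n} \<and> j \<in> {1..n} \<and> i \<noteq> j"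

definition complete_bip :: "nat \<Rightarrow> nat \<Rightarrow> nat \<Rightarrow> bool" where
  "complete_bip m i j \<longleftrightarrow> i \<in> {1..2*m} \<and> j \<in> {1..2*m} \<and> odd i \<noteq> odd j"

definition hyperoct :: "nat \<Rightarrow> nat \<Rightarrow> nat \<Rightarrow> bool" where
  "hyperoct m i j \<longleftrightarrow> i \<in> {1..2*m} \<and> j \<in> {1..2*m} \<and> i \<noteq> j \<and> (i + 1) div 2 \<noteq> (j + 1) div 2"

definition wrap :: "nat \<Rightarrow> nat \<Rightarrow> nat" where
  "wrap n k = (k - 1) mod n + 1"

definition diff_form :: "nat \<Rightarrow> nat \<Rightarrow> nat \<Rightarrow> nat \<Rightarrow> (nat \<times> nat \<Rightarrow> complex)" where
  "diff_form a b i j = (\<lambda>p. var a b p - var i j p)"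

definition cycle_gens :: "nat \<Rightarrow> (nat \<times> nat \<Rightarrow> complex) set" where
  "cycle_gens n = {diff_form 1 (wrap n (1 + d)) i (wrap n (i + d)) | i d.
      i \<in> {2..n} \<and> d \<in> {0..n div 2}}"

definition complete_gens :: "nat \<Rightarrow> (nat \<times> nat \<Rightarrow> complex) set" where
  "complete_gens n = {diff_form 1 1 i i | i. i \<in> {1..n}} \<union>
      {diff_form 1 2 i j | i j. complete_graph n i j}"

definition bip_gens :: "nat \<Rightarrow> (nat \<times> nat \<Rightarrow> complex) set" where
  "bip_gens m = {diff_form 1 1 i i | i. i \<in> {1..2*m}} \<union>
      {diff_form 1 2 i j | i j. complete_bip m i j} \<union>
      {diff_form 1 3 i j | i j. i \<in> {1..2*m} \<and> j \<in> {1..2*m} \<and> i \<noteq> j \<and> \<not> complete_bip m i j}"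

definition hyperoct_gens :: "nat \<Rightarrow> (nat \<times> nat \<Rightarrow> complex) set" where
  "hyperoct_gens m = {diff_form 1 1 i i | i. i \<in> {1..2*m}} \<union>
      {diff_form 1 3 i j | i j. hyperoct m i j} \<union>
      {diff_form 1 2 i j | i j. i \<in> {1..2*m} \<and> j \<in> {1..2*m} \<and> i \<noteq> j \<and> \<not> hyperoct m i j}"

end

theory Submission
  imports Defs
begin

text \<open>The common reason is that all four families are distance-transitive: automorphisms act
  transitively on the unordered pairs at a given distance. Inverses of matrices in the linear space
  commute with automorphisms and are symmetric, so they are constant on distance classes, which gives
  all the listed linear forms. Conversely, the Neumann series of \<open>(I - t A)\<^sup>-\<^sup>1\<close> shows that a linear
  form vanishing on all inverses vanishes on every power of the adjacency matrix \<open>A\<close>. The \<open>k\<close>-th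
  power counts walks of length \<open>k\<close>, hence is zero at distances above \<open>k\<close> and positive at distance
  \<open>k\<close>; by this triangularity the coefficients of the form sum to zero on each distance class. The
  same triangularity makes \<open>A\<close> a root of a monic polynomial of degree (diameter + 1), so that
  explicit eigenvectors suffice to determine the number of eigenvalues.\<close>

section \<open>Spans of linear forms\<close>

lemma sum_delta_mult:
  fixes f :: "'b \<Rightarrow> 'a::semiring_1"
  assumes "finite A" "i \<in> A"
  shows "(\<Sum>l\<in>A. (if i = l then 1 else 0) * f l) = f i"
    and "(\<Sum>l\<in>A. f l * (if l = i then 1 else 0)) = f i"
proof -
  have "(\<Sum>l\<in>A. (if i = l then 1 else 0) * f l) = (\<Sum>l\<in>A. if i = l then f l else 0)"
    by (intro sum.cong) auto
  then show "(\<Sum>l\<in>A. (if i = l then 1 else 0) * f l) = f i" using assms by simp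
  have "(\<Sum>l\<in>A. f l * (if l = i then 1 else 0)) = (\<Sum>l\<in>A. if l = i then f l else 0)"
    by (intro sum.cong) auto
  then show "(\<Sum>l\<in>A. f l * (if l = i then 1 else 0)) = f i" using assms by simp
qed

lemma lspan_base: "g \<in> S \<Longrightarrow> g \<in> lspan S"
  unfolding lspan_def by (rule CollectI, rule exI[of _ "{g}"], rule exI[of _ "\<lambda>_. 1"]) auto

lemma lspan_zero: "(\<lambda>_. 0) \<in> lspan S"
  unfolding lspan_def by (rule CollectI, rule exI[of _ "{}"]) auto

lemma lspan_scale:
  assumes "f \<in> lspan S"
  shows "(\<lambda>p. a * f p) \<in> lspan S"
proof -
  obtain T c where "finite T" "T \<subseteq> S" "f = (\<lambda>p. \<Sum>g\<in>T. c g * g p)"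
    using assms unfolding lspan_def by auto
  then show ?thesis unfolding lspan_def
    by (intro CollectI exI[of _ T] exI[of _ "\<lambda>g. a * c g"]) (auto simp: sum_distrib_left mult.assoc)
qed

lemma lspan_add:
  assumes "f \<in> lspan S" "f' \<in> lspan S"
  shows "(\<lambda>p. f p + f' p) \<in> lspan S"
proof -
  obtain T c where T: "finite T" "T \<subseteq> S" "f = (\<lambda>p. \<Sum>g\<in>T. c g * g p)"
    using assms unfolding lspan_def by auto
  obtain T' c' where T': "finite T'" "T' \<subseteq> S" "f' = (\<lambda>p. \<Sum>g\<in>T'. c' g * g p)"
    using assms unfolding lspan_def by auto
  let ?e = "\<lambda>g. (if g \<in> T then c g else 0) + (if g \<in> T' then c' g else 0)"
  have "f p + f' p = (\<Sum>g\<in>T \<union> T'. ?e g * g p)" for p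
  proof -
    have "f p = (\<Sum>g\<in>T \<union> T'. (if g \<in> T then c g else 0) * g p)"
      unfolding T(3) using T T' by (intro sum.mono_neutral_cong_left) auto
    moreover have "f' p = (\<Sum>g\<in>T \<union> T'. (if g \<in> T' then c' g else 0) * g p)"
      unfolding T'(3) using T T' by (intro sum.mono_neutral_cong_left) auto
    ultimately show ?thesis by (simp add: distrib_right sum.distrib)
  qed
  then show ?thesis unfolding lspan_def using T T'
    by (intro CollectI exI[of _ "T \<union> T'"] exI[of _ ?e]) auto
qed

lemma lspan_sum:
  assumes "finite A" "\<And>x. x \<in> A \<Longrightarrow> f x \<in> lspan S"
  shows "(\<lambda>p. \<Sum>x\<in>A. f x p) \<in> lspan S"
  using assms by (induction A rule: finite_induct) (auto intro: lspan_zero lspan_add)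

lemma finite_Pairs: "finite (Pairs n)"
  by (rule finite_subset[of _ "{1..n} \<times> {1..n}"]) (auto simp: Pairs_def)

lemma lspan_subset_lin_forms:
  assumes "S \<subseteq> lin_forms n E"
  shows "lspan S \<subseteq> lin_forms n E"
proof
  fix f assume "f \<in> lspan S"
  then obtain T c where T: "finite T" "T \<subseteq> S" "f = (\<lambda>p. \<Sum>g\<in>T. c g * g p)"
    unfolding lspan_def by auto
  have "lf_eval n f N = (\<Sum>g\<in>T. c g * lf_eval n g N)" for N
    unfolding lf_eval_def T(3)
    by (simp add: sum_distrib_left sum_distrib_right sum.swap[of _ T] mult.assoc)
  moreover have "g \<in> lin_forms n E" if "g \<in> T" for g using that assms T by auto
  ultimately show "f \<in> lin_forms n E"
    unfolding lin_forms_def by (auto simp: T(3) intro!: sum.neutral)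
qed

lemma var_commute: "var i j = var j i"
  by (simp add: var_def min.commute max.commute)

lemma diff_form_commute: "diff_form a b i j = diff_form a b j i"
  by (simp add: diff_form_def var_commute)

text \<open>Only the upper triangle of \<open>N\<close> is read, so replacing the result by
  \<open>N i j\<close> takes symmetry of \<open>N\<close>, supplied later by
  \<open>inverse_commute\<close>.\<close>

lemma lf_eval_var:
  assumes "i \<in> {1..n}" "j \<in> {1..n}"
  shows "lf_eval n (var i j) N = N (min i j) (max i j)"
proof -
  have "(min i j, max i j) \<in> Pairs n" using assms by (auto simp: Pairs_def)
  then show ?thesis
    by (simp add: lf_eval_def var_def finite_Pairs if_distrib[of "\<lambda>x. x * _"] cong: if_cong)
qed

text \<open>Associativity applied to \<open>N M N'\<close>. It transfers symmetries of a matrix to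
  its inverse: the transformed inverse is another inverse of the same matrix.\<close>

lemma is_inv_unique:
  assumes "is_inv n M N" "is_inv n M N'" "i \<in> {1..n}" "j \<in> {1..n}"
  shows "N i j = N' i j"
proof -
  have "N i j = (\<Sum>k\<in>{1..n}. N i k * (if k = j then 1 else 0))"
    using assms by (simp only: sum_delta_mult finite_atLeastAtMost)
  also have "\<dots> = (\<Sum>k\<in>{1..n}. N i k * matmul n M N' k j)"
    using assms by (intro sum.cong) (auto simp: is_inv_def)
  also have "\<dots> = (\<Sum>l\<in>{1..n}. matmul n N M i l * N' l j)"
    unfolding matmul_def sum_distrib_left sum_distrib_right
    by (subst sum.swap) (simp add: mult.assoc)
  also have "\<dots> = (\<Sum>l\<in>{1..n}. (if i = l then 1 else 0) * N' l j)"
    using assms by (intro sum.cong) (auto simp: is_inv_def)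
  also have "\<dots> = N' i j"
    using assms by (simp only: sum_delta_mult finite_atLeastAtMost)
  finally show ?thesis .
qed

text \<open>The constant term is the limit at \<open>0\<close>; dividing by \<open>x\<close> shifts
  the series and the induction repeats. This division is why the hypothesis leaves out
  \<open>x = 0\<close>.\<close>

lemma power_series_zero:
  fixes a :: "nat \<Rightarrow> 'a::{real_normed_field,banach}"
  assumes "0 < s" "\<And>x. x \<noteq> 0 \<Longrightarrow> norm x < s \<Longrightarrow> (\<lambda>k. a k * x ^ k) sums 0"
  shows "a k = 0"
  using assms(2)
proof (induction k arbitrary: a)
  have a0: "a 0 = 0" if "\<And>x. x \<noteq> 0 \<Longrightarrow> norm x < s \<Longrightarrow> (\<lambda>k. a k * x ^ k) sums 0" for a :: "nat \<Rightarrow> 'a"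
    using powser_limit_0_strong[OF assms(1), of a "\<lambda>_. 0"] that
    by (metis LIM_const_eq)
  {
    case 0
    then show ?case by (rule a0)
  next
    case (Suc k)
    have "(\<lambda>k. a (Suc k) * x ^ k) sums 0" if x: "x \<noteq> 0" "norm x < s" for x
    proof -
      have "(\<lambda>k. a (Suc k) * x ^ Suc k) sums 0"
        using Suc.prems[OF x] a0[of a, OF Suc.prems] by (subst sums_Suc_iff) simp
      then have "(\<lambda>k. inverse x * (a (Suc k) * x ^ Suc k)) sums (inverse x * 0)"
        by (rule sums_mult)
      moreover have "inverse x * (a (Suc k) * x ^ Suc k) = a (Suc k) * x ^ k" for k
        using x by (simp add: field_simps)
      ultimately show ?thesis by (simp only: mult_zero_right)
    qed
    then show ?case by (rule Suc.IH)
  }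
qed

section \<open>Walks and distance\<close>

text \<open>Entries of the powers of the adjacency matrix, kept as natural numbers so that nonzero
  means positive and nothing can cancel.\<close>

primrec walks :: "nat \<Rightarrow> (nat \<Rightarrow> nat \<Rightarrow> bool) \<Rightarrow> nat \<Rightarrow> nat \<Rightarrow> nat \<Rightarrow> nat" where
  "walks n E 0 i j = (if i = j then 1 else 0)"
| "walks n E (Suc k) i j = (\<Sum>l\<in>{1..n}. walks n E k i l * (if E l j then 1 else 0))"

text \<open>Splitting off the initial edge instead of the final one serves the second inverse
  identity for the Neumann series and the symmetry of walk counts.\<close>

lemma walks_Suc_left:
  assumes "i \<in> {1..n}" "j \<in> {1..n}"
  shows "walks n E (Suc k) i j = (\<Sum>l\<in>{1..n}. (if E i l then 1 else 0) * walks n E k l j)"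
  using assms(2)
proof (induction k arbitrary: j)
  case 0
  then show ?case using assms by (simp only: walks.simps sum_delta_mult finite_atLeastAtMost)
next
  case (Suc k)
  have "walks n E (Suc (Suc k)) i j = (\<Sum>l\<in>{1..n}. walks n E (Suc k) i l * (if E l j then 1 else 0))"
    by simp
  also have "\<dots> = (\<Sum>l\<in>{1..n}. (\<Sum>m\<in>{1..n}. (if E i m then 1 else 0) * walks n E k m l) * (if E l j then 1 else 0))"
    using Suc.IH by (intro sum.cong) (auto simp del: walks.simps)
  also have "\<dots> = (\<Sum>m\<in>{1..n}. (if E i m then 1 else 0) * walks n E (Suc k) m j)"
    unfolding walks.simps sum_distrib_left sum_distrib_right
    by (subst sum.swap) (simp add: mult.assoc)
  finally show ?case .
qed

text \<open>This crude bound dominates the Neumann series by a geometric series with ratio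
  \<open>norm t * n\<close>.\<close>

lemma walks_le: "i \<in> {1..n} \<Longrightarrow> walks n E k i j \<le> n ^ k"
proof (induction k arbitrary: j)
  case (Suc k)
  have "walks n E (Suc k) i j \<le> (\<Sum>l\<in>{1..n}. n ^ k)"
    unfolding walks.simps using Suc by (intro sum_mono) auto
  then show ?case by simp
qed auto

lemma walks_aut:
  assumes "\<sigma> \<in> aut n E" "i \<in> {1..n}" "j \<in> {1..n}"
  shows "walks n E k (\<sigma> i) (\<sigma> j) = walks n E k i j"
  using assms(3)
proof (induction k arbitrary: j)
  case 0
  have "\<sigma> permutes {1..n}" using assms by (simp add: aut_def)
  then show ?case by (auto dest: permutes_inj injD)
next
  case (Suc k)
  have p: "\<sigma> permutes {1..n}" using assms by (simp add: aut_def)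
  have "walks n E (Suc k) (\<sigma> i) (\<sigma> j) = (\<Sum>l\<in>{1..n}. walks n E k (\<sigma> i) (\<sigma> l) * (if E (\<sigma> l) (\<sigma> j) then 1 else 0))"
    using sum.permute[OF p, of "\<lambda>l. walks n E k (\<sigma> i) l * (if E l (\<sigma> j) then 1 else 0)"]
    by (simp add: o_def)
  also have "\<dots> = walks n E (Suc k) i j"
    unfolding walks.simps using Suc assms by (intro sum.cong) (auto simp: aut_def)
  finally show ?case .
qed

lemma aut_inv:
  assumes "\<sigma> \<in> aut n E"
  shows "inv \<sigma> \<in> aut n E"
proof -
  have p: "\<sigma> permutes {1..n}" using assms by (simp add: aut_def)
  have "E (inv \<sigma> i) (inv \<sigma> j) = E i j" if "i \<in> {1..n}" "j \<in> {1..n}" for i j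
  proof -
    have "inv \<sigma> i \<in> {1..n}" "inv \<sigma> j \<in> {1..n}"
      using that permutes_in_image[OF permutes_inv[OF p]] by simp_all
    then have "E (\<sigma> (inv \<sigma> i)) (\<sigma> (inv \<sigma> j)) = E (inv \<sigma> i) (inv \<sigma> j)"
      using assms by (auto simp: aut_def)
    then show ?thesis by (simp add: permutes_inverses[OF p])
  qed
  then show ?thesis using permutes_inv[OF p] by (simp add: aut_def)
qed

lemma aut_in_range:
  assumes "\<sigma> \<in> aut n E" "i \<in> {1..n}"
  shows "\<sigma> i \<in> {1..n}"
proof -
  have "\<sigma> permutes {1..n}" using assms by (simp add: aut_def)
  from permutes_in_image[OF this] show ?thesis using assms(2) by simp
qed

lemma aut_comp:
  assumes "\<sigma> \<in> aut n E" "\<tau> \<in> aut n E"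
  shows "\<sigma> \<circ> \<tau> \<in> aut n E"
proof -
  have "E (\<sigma> (\<tau> i)) (\<sigma> (\<tau> j)) = E i j" if "i \<in> {1..n}" "j \<in> {1..n}" for i j
  proof -
    have "E (\<sigma> (\<tau> i)) (\<sigma> (\<tau> j)) = E (\<tau> i) (\<tau> j)"
      using aut_in_range[OF assms(2)] that assms(1) by (simp add: aut_def)
    then show ?thesis using that assms(2) by (simp add: aut_def)
  qed
  moreover have "\<sigma> \<circ> \<tau> permutes {1..n}"
    using assms by (intro permutes_compose) (auto simp: aut_def)
  ultimately show ?thesis by (simp add: aut_def)
qed

section \<open>Eigenvectors and the Neumann series\<close>

definition eigvals :: "nat \<Rightarrow> (nat \<Rightarrow> nat \<Rightarrow> bool) \<Rightarrow> complex set" where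
  "eigvals n E = {\<mu>. \<exists>v. (\<exists>i\<in>{1..n}. v i \<noteq> 0) \<and>
      (\<forall>i\<in>{1..n}. (\<Sum>j\<in>{1..n}. adj E i j * v j) = \<mu> * v i)}"

lemma walks_eigvec:
  assumes "\<And>i. i \<in> {1..n} \<Longrightarrow> (\<Sum>j\<in>{1..n}. adj E i j * v j) = \<mu> * v i" "i \<in> {1..n}"
  shows "(\<Sum>j\<in>{1..n}. of_nat (walks n E k i j) * v j) = \<mu> ^ k * v i"
proof (induction k)
  case 0
  have "(\<Sum>j\<in>{1..n}. of_nat (walks n E 0 i j) * v j) = (\<Sum>j\<in>{1..n}. (if i = j then 1 else 0) * v j)"
    by (intro sum.cong) auto
  then show ?case using assms(2) by (simp only: sum_delta_mult finite_atLeastAtMost power_0 mult_1)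
next
  case (Suc k)
  have "(\<Sum>j\<in>{1..n}. of_nat (walks n E (Suc k) i j) * v j)
      = (\<Sum>l\<in>{1..n}. of_nat (walks n E k i l) * (\<Sum>j\<in>{1..n}. adj E l j * v j))"
    unfolding walks.simps of_nat_sum sum_distrib_left sum_distrib_right
    by (subst sum.swap) (intro sum.cong refl, simp add: adj_def)
  also have "\<dots> = (\<Sum>l\<in>{1..n}. of_nat (walks n E k i l) * (\<mu> * v l))"
    using assms(1) by (intro sum.cong) auto
  also have "\<dots> = \<mu> * (\<Sum>l\<in>{1..n}. of_nat (walks n E k i l) * v l)"
    by (simp add: sum_distrib_left mult_ac)
  finally show ?case using Suc by (simp add: mult_ac)
qed

lemma Neumann_is_inv:
  fixes t :: complex and E :: "nat \<Rightarrow> nat \<Rightarrow> bool"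
  assumes t: "norm t * n < 1"
  defines "N \<equiv> \<lambda>i j. \<Sum>k. of_nat (walks n E k i j) * t ^ k"
  shows "is_inv n (Lmat E 1 (- t)) N"
    and "\<And>i j. i \<in> {1..n} \<Longrightarrow> (\<lambda>k. of_nat (walks n E k i j) * t ^ k) sums N i j"
proof -
  show s: "(\<lambda>k. of_nat (walks n E k i j) * t ^ k) sums N i j" if "i \<in> {1..n}" for i j
  proof -
    have "summable (\<lambda>k. of_nat (walks n E k i j) * t ^ k)"
    proof (rule summable_comparison_test')
      show "summable (\<lambda>k. (norm t * n) ^ k)" using t by (simp add: summable_geometric)
      fix k
      have "norm (of_nat (walks n E k i j) * t ^ k) = real (walks n E k i j) * norm t ^ k"
        by (simp add: norm_mult norm_power)
      also have "\<dots> \<le> real (n ^ k) * norm t ^ k"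
        using walks_le[OF that] by (intro mult_right_mono of_nat_mono) auto
      finally show "norm (of_nat (walks n E k i j) * t ^ k) \<le> (norm t * n) ^ k"
        by (simp add: power_mult_distrib mult.commute)
    qed
    then show ?thesis by (simp add: N_def summable_sums)
  qed
  \<comment> \<open>Dropping the term \<open>k = 0\<close>, the identity matrix, leaves
    \<open>N - I\<close>. The remaining terms regroup as \<open>t\<close> times \<open>N A\<close>
    or \<open>A N\<close>, according to which end of a walk is split off.\<close>
  have step: "(\<lambda>k. of_nat (walks n E (Suc k) i j) * t ^ Suc k) sums (N i j - (if i = j then 1 else 0))"
    if "i \<in> {1..n}" for i j
    using s[OF that, of j] by (subst sums_Suc_iff) (auto split: if_splits)
  have R: "matmul n N (Lmat E 1 (- t)) i j = (if i = j then 1 else 0)"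
    if "i \<in> {1..n}" "j \<in> {1..n}" for i j
  proof -
    have h: "(\<lambda>k. \<Sum>l\<in>{1..n}. t * adj E l j * (of_nat (walks n E k i l) * t ^ k)) sums (\<Sum>l\<in>{1..n}. t * adj E l j * N i l)"
      using s[OF that(1)] by (intro sums_sum sums_mult) auto
    have e: "(\<Sum>l\<in>{1..n}. t * adj E l j * (of_nat (walks n E k i l) * t ^ k)) = of_nat (walks n E (Suc k) i j) * t ^ Suc k" for k
      by (simp add: sum_distrib_right) (intro sum.cong, auto simp: adj_def)
    have "(\<Sum>l\<in>{1..n}. t * adj E l j * N i l) = N i j - (if i = j then 1 else 0)"
      by (rule sums_unique2[OF h[unfolded e] step[OF that(1)]])
    moreover have "matmul n N (Lmat E 1 (- t)) i j = N i j - (\<Sum>l\<in>{1..n}. t * adj E l j * N i l)"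
    proof -
      have "matmul n N (Lmat E 1 (- t)) i j = (\<Sum>l\<in>{1..n}. N i l * (if l = j then 1 else 0) - t * adj E l j * N i l)"
        unfolding matmul_def Lmat_def by (intro sum.cong) (auto simp: algebra_simps)
      then show ?thesis using that by (simp only: sum_subtractf sum_delta_mult finite_atLeastAtMost)
    qed
    ultimately show ?thesis by simp
  qed
  have L: "matmul n (Lmat E 1 (- t)) N i j = (if i = j then 1 else 0)"
    if "i \<in> {1..n}" "j \<in> {1..n}" for i j
  proof -
    have h: "(\<lambda>k. \<Sum>l\<in>{1..n}. t * adj E i l * (of_nat (walks n E k l j) * t ^ k)) sums (\<Sum>l\<in>{1..n}. t * adj E i l * N l j)"
      using s by (intro sums_sum sums_mult) auto
    have e: "(\<Sum>l\<in>{1..n}. t * adj E i l * (of_nat (walks n E k l j) * t ^ k)) = of_nat (walks n E (Suc k) i j) * t ^ Suc k" for k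
      unfolding walks_Suc_left[OF that]
      by (simp add: sum_distrib_right) (intro sum.cong, auto simp: adj_def)
    have "(\<Sum>l\<in>{1..n}. t * adj E i l * N l j) = N i j - (if i = j then 1 else 0)"
      by (rule sums_unique2[OF h[unfolded e] step[OF that(1)]])
    moreover have "matmul n (Lmat E 1 (- t)) N i j = N i j - (\<Sum>l\<in>{1..n}. t * adj E i l * N l j)"
    proof -
      have "matmul n (Lmat E 1 (- t)) N i j = (\<Sum>l\<in>{1..n}. (if i = l then 1 else 0) * N l j - t * adj E i l * N l j)"
        unfolding matmul_def Lmat_def by (intro sum.cong) (auto simp: algebra_simps)
      then show ?thesis using that by (simp only: sum_subtractf sum_delta_mult finite_atLeastAtMost)
    qed
    ultimately show ?thesis by simp
  qed
  show "is_inv n (Lmat E 1 (- t)) N" unfolding is_inv_def using L R by blast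
qed

text \<open>Evaluated at the Neumann series, the form is a power series in \<open>t\<close> whose
  coefficient at \<open>k\<close> is its value on the \<open>k\<close>-th power; vanishing for all
  small \<open>t\<close> kills each coefficient.\<close>

lemma lin_forms_walks:
  assumes "c \<in> lin_forms n E"
  shows "(\<Sum>p\<in>Pairs n. c p * of_nat (walks n E k (fst p) (snd p))) = 0"
proof (rule power_series_zero[where a = "\<lambda>k. \<Sum>p\<in>Pairs n. c p * of_nat (walks n E k (fst p) (snd p))" and s = "1 / (real n + 1)"])
  \<comment> \<open>The radius \<open>1 / (n + 1)\<close> is positive even for \<open>n = 0\<close>
    and stays inside the region of convergence.\<close>
  show "(0::real) < 1 / (real n + 1)" by simp
  fix t :: complex assume t: "norm t < 1 / (real n + 1)"
  have "norm t * n \<le> norm t * (real n + 1)" by (intro mult_left_mono) auto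
  also have "\<dots> < 1" using t by (simp add: field_simps)
  finally have t': "norm t * n < 1" .
  define N where "N = (\<lambda>i j. \<Sum>k. of_nat (walks n E k i j) * t ^ k)"
  have "(\<lambda>k. \<Sum>p\<in>Pairs n. c p * (of_nat (walks n E k (fst p) (snd p)) * t ^ k))
        sums (\<Sum>p\<in>Pairs n. c p * N (fst p) (snd p))"
    unfolding N_def using Neumann_is_inv(2)[OF t', of _ E]
    by (intro sums_sum sums_mult) (auto simp: Pairs_def)
  moreover have "(\<Sum>p\<in>Pairs n. c p * N (fst p) (snd p)) = 0"
    using assms Neumann_is_inv(1)[OF t', of E] unfolding lin_forms_def lf_eval_def N_def by blast
  ultimately show "(\<lambda>k. (\<Sum>p\<in>Pairs n. c p * of_nat (walks n E k (fst p) (snd p))) * t ^ k) sums 0"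
    by (simp add: sum_distrib_right mult.assoc)
qed

section \<open>Distance-transitive graphs\<close>

text \<open>The map \<open>cl\<close> is the graph distance, \<open>D\<close> the diameter, and \<open>r d\<close> a vertex at distance \<open>d\<close>
  from the vertex 1.\<close>

locale distance_graph =
  fixes n :: nat and E :: "nat \<Rightarrow> nat \<Rightarrow> bool" and cl :: "nat \<Rightarrow> nat \<Rightarrow> nat" and D :: nat
    and r :: "nat \<Rightarrow> nat"
  assumes n_pos: "1 \<le> n"
    and E_sym: "\<lbrakk>i \<in> {1..n}; j \<in> {1..n}; E i j\<rbrakk> \<Longrightarrow> E j i"
    and cl_commute: "\<lbrakk>i \<in> {1..n}; j \<in> {1..n}\<rbrakk> \<Longrightarrow> cl i j = cl j i"
    and cl_eq_0_iff: "\<lbrakk>i \<in> {1..n}; j \<in> {1..n}\<rbrakk> \<Longrightarrow> cl i j = 0 \<longleftrightarrow> i = j"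
    and cl_edge: "\<lbrakk>i \<in> {1..n}; j \<in> {1..n}; k \<in> {1..n}; E j k\<rbrakk> \<Longrightarrow> cl i k \<le> Suc (cl i j)"
    and cl_pred: "\<lbrakk>i \<in> {1..n}; j \<in> {1..n}; cl i j = Suc d\<rbrakk> \<Longrightarrow> \<exists>k\<in>{1..n}. E k j \<and> cl i k = d"
    and cl_le: "\<lbrakk>i \<in> {1..n}; j \<in> {1..n}\<rbrakk> \<Longrightarrow> cl i j \<le> D"
    and r_in: "d \<le> D \<Longrightarrow> r d \<in> {1..n}"
    and cl_r: "d \<le> D \<Longrightarrow> cl 1 (r d) = d"
begin

lemma one_in: "1 \<in> {1..n}"
  using n_pos by simp

lemma walks_eq_0: "\<lbrakk>i \<in> {1..n}; j \<in> {1..n}; k < cl i j\<rbrakk> \<Longrightarrow> walks n E k i j = 0"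
proof (induction k arbitrary: j)
  case 0
  then show ?case using cl_eq_0_iff[of i j] by auto
next
  case (Suc k)
  have "walks n E k i l * (if E l j then 1 else 0) = 0" if l: "l \<in> {1..n}" for l
  proof (cases "E l j")
    case True
    then have "k < cl i l" using cl_edge[OF Suc.prems(1) l Suc.prems(2)] Suc.prems(3) by simp
    then show ?thesis using Suc l by simp
  qed simp
  then show ?case by (simp only: walks.simps sum.neutral_const cong: sum.cong)
qed

text \<open>\<open>cl_pred\<close> supplies the last edge of a shortest walk, and a single nonzero
  summand suffices because all summands are natural numbers.\<close>

lemma walks_cl_pos: "\<lbrakk>i \<in> {1..n}; j \<in> {1..n}; cl i j = k\<rbrakk> \<Longrightarrow> 0 < walks n E k i j"
proof (induction k arbitrary: j)
  case 0
  then show ?case using cl_eq_0_iff[of i j] by auto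
next
  case (Suc k)
  then obtain l where l: "l \<in> {1..n}" "E l j" "cl i l = k" using cl_pred by blast
  then have "0 < walks n E k i l * (if E l j then 1 else 0)" using Suc by simp
  also have "\<dots> \<le> walks n E (Suc k) i j"
    unfolding walks.simps using l by (intro member_le_sum) auto
  finally show ?case .
qed

text \<open>Once \<open>cl\<close> is read off from walk counts, its invariance under automorphisms
  follows from \<open>walks_aut\<close> for all families at once.\<close>

lemma cl_eq_Least:
  assumes "i \<in> {1..n}" "j \<in> {1..n}"
  shows "cl i j = (LEAST k. walks n E k i j \<noteq> 0)"
proof (rule sym, rule Least_equality)
  show "walks n E (cl i j) i j \<noteq> 0" using walks_cl_pos[OF assms refl] by simp
  show "cl i j \<le> k" if "walks n E k i j \<noteq> 0" for k
    using walks_eq_0[OF assms] that by (meson not_le)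
qed

lemma cl_aut:
  assumes "\<sigma> \<in> aut n E" "i \<in> {1..n}" "j \<in> {1..n}"
  shows "cl (\<sigma> i) (\<sigma> j) = cl i j"
  using assms by (simp only: cl_eq_Least aut_in_range walks_aut)

text \<open>Move \<open>i\<close> to \<open>i'\<close>, then correct the image of \<open>j\<close>
  by an automorphism fixing \<open>i'\<close>. The correction exists because \<open>cl\<close> is
  invariant, so that image and \<open>j'\<close> are equally far from \<open>i'\<close>.\<close>

lemma transitive_if:
  assumes vertex: "\<And>i i'. \<lbrakk>i \<in> {1..n}; i' \<in> {1..n}\<rbrakk> \<Longrightarrow> \<exists>\<sigma>\<in>aut n E. \<sigma> i = i'"
    and stabilizer: "\<And>i j j'. \<lbrakk>i \<in> {1..n}; j \<in> {1..n}; j' \<in> {1..n}; cl i j = cl i j'\<rbrakk>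
      \<Longrightarrow> \<exists>\<sigma>\<in>aut n E. \<sigma> i = i \<and> \<sigma> j = j'"
    and "i \<in> {1..n}" "j \<in> {1..n}" "i' \<in> {1..n}" "j' \<in> {1..n}" "cl i j = cl i' j'"
  shows "\<exists>\<sigma>\<in>aut n E. \<sigma> i = i' \<and> \<sigma> j = j'"
proof -
  obtain \<sigma> where \<sigma>: "\<sigma> \<in> aut n E" "\<sigma> i = i'" using assms by blast
  then have "cl i' (\<sigma> j) = cl i' j'" using cl_aut assms by metis
  then obtain \<tau> where \<tau>: "\<tau> \<in> aut n E" "\<tau> i' = i'" "\<tau> (\<sigma> j) = j'"
    using stabilizer[of i' "\<sigma> j" j'] aut_in_range[OF \<sigma>(1)] assms by blast
  show ?thesis using aut_comp[OF \<tau>(1) \<sigma>(1)] \<sigma> \<tau> by (intro bexI[of _ "\<tau> \<circ> \<sigma>"]) auto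
qed

lemma walks_commute:
  assumes "i \<in> {1..n}" "j \<in> {1..n}"
  shows "walks n E k i j = walks n E k j i"
  using assms
proof (induction k arbitrary: i j)
  case (Suc k)
  have "walks n E (Suc k) i j = (\<Sum>l\<in>{1..n}. (if E j l then 1 else 0) * walks n E k l i)"
    unfolding walks.simps
  proof (rule sum.cong[OF refl])
    fix l assume "l \<in> {1..n}"
    then show "walks n E k i l * (if E l j then 1 else 0) = (if E j l then 1 else 0) * walks n E k l i"
      using Suc E_sym[of l j] E_sym[of j l] by auto
  qed
  then show ?case using walks_Suc_left[OF Suc.prems(2,1)] by simp
qed auto

end

text \<open>Both orientations are allowed because orbits concern unordered pairs; with this freedom
  rotations alone handle the cycles. Walk counts and inverses are symmetric, so a reversing
  automorphism serves equally well.\<close>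

locale distance_transitive_graph = distance_graph +
  assumes transitive:
    "\<lbrakk>i \<in> {1..n}; j \<in> {1..n}; i' \<in> {1..n}; j' \<in> {1..n}; cl i j = cl i' j'\<rbrakk>
      \<Longrightarrow> \<exists>\<sigma>\<in>aut n E. (\<sigma> i = i' \<and> \<sigma> j = j') \<or> (\<sigma> i = j' \<and> \<sigma> j = i')"
begin

lemma walks_cl:
  assumes "i \<in> {1..n}" "j \<in> {1..n}" "i' \<in> {1..n}" "j' \<in> {1..n}" "cl i j = cl i' j'"
  shows "walks n E k i j = walks n E k i' j'"
  using transitive[OF assms] walks_aut[of _ n E i j k] walks_commute assms by metis

section \<open>Inverses are constant on distance classes\<close>

lemma Lmat_commute:
  assumes "i \<in> {1..n}" "j \<in> {1..n}"
  shows "Lmat E a b i j = Lmat E a b j i"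
  using assms E_sym by (auto simp: Lmat_def adj_def)

text \<open>The transpose of \<open>N\<close> inverts the same symmetric matrix, and inverses are
  unique.\<close>

lemma inverse_commute:
  assumes inv: "is_inv n (Lmat E a b) N" and "i \<in> {1..n}" "j \<in> {1..n}"
  shows "N i j = N j i"
proof -
  have "matmul n (Lmat E a b) (\<lambda>i j. N j i) i j = matmul n N (Lmat E a b) j i"
    "matmul n (\<lambda>i j. N j i) (Lmat E a b) i j = matmul n (Lmat E a b) N j i"
    if "i \<in> {1..n}" "j \<in> {1..n}" for i j
    unfolding matmul_def using that Lmat_commute by (auto intro!: sum.cong simp: mult.commute)
  then have "is_inv n (Lmat E a b) (\<lambda>i j. N j i)"
    using inv unfolding is_inv_def by simp
  from is_inv_unique[OF inv this assms(2,3)] show ?thesis .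
qed

text \<open>Reindexing \<open>N\<close> along \<sigma> again inverts \<open>Lmat E a b\<close>,
  which \<sigma> leaves invariant; uniqueness of inverses concludes.\<close>

lemma inverse_aut:
  assumes inv: "is_inv n (Lmat E a b) N" and \<sigma>: "\<sigma> \<in> aut n E" and "i \<in> {1..n}" "j \<in> {1..n}"
  shows "N (\<sigma> i) (\<sigma> j) = N i j"
proof -
  have p: "\<sigma> permutes {1..n}" using \<sigma> by (simp add: aut_def)
  have L: "Lmat E a b (\<sigma> i) (\<sigma> j) = Lmat E a b i j" if "i \<in> {1..n}" "j \<in> {1..n}" for i j
    using \<sigma> that permutes_inj[OF p] by (auto simp: Lmat_def adj_def aut_def dest: injD)
  have "matmul n (Lmat E a b) (\<lambda>i j. N (\<sigma> i) (\<sigma> j)) i j = matmul n (Lmat E a b) N (\<sigma> i) (\<sigma> j)"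
    "matmul n (\<lambda>i j. N (\<sigma> i) (\<sigma> j)) (Lmat E a b) i j = matmul n N (Lmat E a b) (\<sigma> i) (\<sigma> j)"
    if "i \<in> {1..n}" "j \<in> {1..n}" for i j
    unfolding matmul_def using that L
      sum.permute[OF p, of "\<lambda>k. Lmat E a b (\<sigma> i) k * N k (\<sigma> j)"]
      sum.permute[OF p, of "\<lambda>k. N (\<sigma> i) k * Lmat E a b k (\<sigma> j)"] by auto
  then have "is_inv n (Lmat E a b) (\<lambda>i j. N (\<sigma> i) (\<sigma> j))"
    using inv aut_in_range[OF \<sigma>] permutes_inj[OF p] unfolding is_inv_def
    by (auto simp del: atLeastAtMost_iff dest: injD)
  from is_inv_unique[OF this inv assms(3,4)] show ?thesis .
qed

lemma diff_form_in_lin_forms: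
  assumes ij: "i \<in> {1..n}" "j \<in> {1..n}" "i' \<in> {1..n}" "j' \<in> {1..n}" and eq: "cl i j = cl i' j'"
  shows "diff_form i j i' j' \<in> lin_forms n E"
proof -
  have "lf_eval n (diff_form i j i' j') N = 0" if N: "is_inv n (Lmat E a b) N" for a b N
  proof -
    have v: "lf_eval n (var i j) N = N i j" if "i \<in> {1..n}" "j \<in> {1..n}" for i j
      using lf_eval_var[OF that] inverse_commute[OF N that] by (cases "i \<le> j") auto
    have "N i j = N i' j'"
      using transitive[OF assms] inverse_aut[OF N _ ij(1,2)] inverse_commute[OF N ij(3,4)] by metis
    moreover have "lf_eval n (diff_form i j i' j') N = lf_eval n (var i j) N - lf_eval n (var i' j') N"
      by (simp add: lf_eval_def diff_form_def left_diff_distrib sum_subtractf)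
    ultimately show ?thesis using v ij by simp
  qed
  moreover have "diff_form i j i' j' p = 0" if "p \<notin> Pairs n" for p
    using that ij by (auto simp: diff_form_def var_def Pairs_def)
  ultimately show ?thesis by (auto simp: lin_forms_def)
qed

section \<open>Linear forms and distance classes\<close>

abbreviation class_sum :: "(nat \<times> nat \<Rightarrow> complex) \<Rightarrow> nat \<Rightarrow> complex" where
  "class_sum c d \<equiv> (\<Sum>p\<in>{p\<in>Pairs n. cl (fst p) (snd p) = d}. c p)"

lemma Pairs_D:
  assumes "p \<in> Pairs n"
  shows "fst p \<in> {1..n}" "snd p \<in> {1..n}"
  using assms by (auto simp: Pairs_def)

lemma sum_classes:
  shows "(\<Sum>p\<in>Pairs n. f p) = (\<Sum>d\<le>D. \<Sum>p\<in>{p\<in>Pairs n. cl (fst p) (snd p) = d}. f p)"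
proof (rule sum.group[symmetric])
  show "(\<lambda>p. cl (fst p) (snd p)) ` Pairs n \<subseteq> {..D}" using cl_le[OF Pairs_D] by blast
qed (simp_all add: finite_Pairs)

text \<open>Testing on the power with exponent \<open>d\<close> isolates class \<open>d\<close>:
  smaller distances drop out by induction, larger ones because walks of length \<open>d\<close> do
  not reach them, and the factor left over is positive.\<close>

lemma class_sum_eq_0:
  assumes c: "c \<in> lin_forms n E" and "d \<le> D"
  shows "class_sum c d = 0"
  using assms(2)
proof (induction d rule: less_induct)
  case (less d)
  let ?w = "\<lambda>e. of_nat (walks n E d 1 (r e)) :: complex"
  have "0 = (\<Sum>e\<le>D. \<Sum>p\<in>{p\<in>Pairs n. cl (fst p) (snd p) = e}. c p * of_nat (walks n E d (fst p) (snd p)))"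
    unfolding sum_classes[symmetric] using lin_forms_walks[OF c, of d] by simp
  also have "\<dots> = (\<Sum>e\<le>D. class_sum c e * ?w e)"
    unfolding sum_distrib_right
  proof (intro sum.cong refl)
    fix e p assume e: "e \<in> {..D}" and p: "p \<in> {p \<in> Pairs n. cl (fst p) (snd p) = e}"
    then have "cl (fst p) (snd p) = cl 1 (r e)" using cl_r by simp
    then have "walks n E d (fst p) (snd p) = walks n E d 1 (r e)"
      using walks_cl[OF Pairs_D(1)[of p] Pairs_D(2)[of p] one_in r_in[of e]] e p by simp
    then show "c p * of_nat (walks n E d (fst p) (snd p)) = c p * ?w e" by simp
  qed
  also have "\<dots> = (\<Sum>e\<in>{d}. class_sum c e * ?w e)"
  proof (rule sum.mono_neutral_right)
    show "\<forall>e\<in>{..D} - {d}. class_sum c e * ?w e = 0"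
    proof
      fix e assume e: "e \<in> {..D} - {d}"
      show "class_sum c e * ?w e = 0"
      proof (cases "e < d")
        case True
        then show ?thesis using less e by simp
      next
        case False
        then have "walks n E d 1 (r e) = 0" using e walks_eq_0 one_in r_in cl_r by simp
        then show ?thesis by simp
      qed
    qed
  qed (use less in auto)
  finally have "class_sum c d * ?w d = 0" by simp
  moreover have "0 < walks n E d 1 (r d)"
    using walks_cl_pos[OF one_in r_in cl_r] less.prems by blast
  ultimately show ?case by simp
qed

definition distance_forms :: "(nat \<times> nat \<Rightarrow> complex) set" where
  "distance_forms = {diff_form i j i' j' | i j i' j'.
      i \<in> {1..n} \<and> j \<in> {1..n} \<and> i' \<in> {1..n} \<and> j' \<in> {1..n} \<and> cl i j = cl i' j'}"

lemma distance_formsI: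
  "\<lbrakk>i \<in> {1..n}; j \<in> {1..n}; i' \<in> {1..n}; j' \<in> {1..n}; cl i j = cl i' j'\<rbrakk>
    \<Longrightarrow> diff_form i j i' j' \<in> distance_forms"
  unfolding distance_forms_def by blast

text \<open>Replacing each variable in \<open>c\<close> by its class representative gives the
  combination of representatives weighted by the class sums, which is zero; so \<open>c\<close> is a
  combination of the differences in \<open>gen\<close>. The criterion serves both the symmetry forms
  and the explicit lists.\<close>

theorem lin_forms_eq_lspan:
  assumes sub: "\<And>g. g \<in> G \<Longrightarrow> g \<in> distance_forms"
    and gen: "\<And>i j. \<lbrakk>i \<in> {1..n}; j \<in> {1..n}\<rbrakk> \<Longrightarrow> diff_form 1 (r (cl i j)) i j \<in> lspan G"
  shows "lin_forms n E = lspan G"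
proof
  show "lspan G \<subseteq> lin_forms n E"
  proof (rule lspan_subset_lin_forms)
    have "distance_forms \<subseteq> lin_forms n E"
      unfolding distance_forms_def using diff_form_in_lin_forms by blast
    then show "G \<subseteq> lin_forms n E" using sub by blast
  qed
  show "lin_forms n E \<subseteq> lspan G"
  proof
    fix c assume c: "c \<in> lin_forms n E"
    let ?r = "\<lambda>q. var 1 (r (cl (fst q) (snd q)))"
    \<comment> \<open>The minus sign appears because \<open>diff_form\<close> subtracts the variable
      from its representative.\<close>
    have eq: "c p = (\<Sum>q\<in>Pairs n. (- c q) * diff_form 1 (r (cl (fst q) (snd q))) (fst q) (snd q) p)" for p
    proof -
      have "(\<Sum>q\<in>Pairs n. c q * ?r q p) = (\<Sum>d\<le>D. class_sum c d * var 1 (r d) p)"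
        unfolding sum_classes sum_distrib_right by (intro sum.cong) auto
      also have "\<dots> = 0" using class_sum_eq_0[OF c] by simp
      finally have 0: "(\<Sum>q\<in>Pairs n. c q * ?r q p) = 0" .
      have "(\<Sum>q\<in>Pairs n. c q * var (fst q) (snd q) p) = (\<Sum>q\<in>Pairs n. if q = p then c q else 0)"
        by (intro sum.cong refl) (auto simp: var_def Pairs_def)
      also have "\<dots> = c p" using c unfolding lin_forms_def by (cases p) (simp add: finite_Pairs)
      finally show ?thesis using 0
        by (simp add: diff_form_def algebra_simps sum.distrib sum_subtractf sum_negf)
    qed
    show "c \<in> lspan G"
      by (subst ext[of c, OF eq]) (intro lspan_sum lspan_scale finite_Pairs gen Pairs_D)
  qed
qed

text \<open>If \<sigma> carries the pair of \<open>1\<close> and \<open>r (cl i j)\<close> to that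
  of \<open>i\<close> and \<open>j\<close>, in either order, then \<open>inv \<sigma>\<close> pulls
  the variable at \<open>i\<close>, \<open>j\<close> back to the representative.\<close>

theorem lin_forms_eq_lspan_sym_forms: "lin_forms n E = lspan (sym_forms n E)"
proof (rule lin_forms_eq_lspan)
  fix g assume "g \<in> sym_forms n E"
  then obtain \<sigma> i j where g: "\<sigma> \<in> aut n E" "i \<in> {1..n}" "j \<in> {1..n}" "g = diff_form (inv \<sigma> i) (inv \<sigma> j) i j"
    unfolding sym_forms_def diff_form_def by blast
  show "g \<in> distance_forms"
    unfolding g(4)
    by (rule distance_formsI[OF aut_in_range[OF aut_inv[OF g(1)] g(2)]
          aut_in_range[OF aut_inv[OF g(1)] g(3)] g(2,3) cl_aut[OF aut_inv[OF g(1)] g(2,3)]])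
next
  fix i j assume ij: "i \<in> {1..n}" "j \<in> {1..n}"
  let ?b = "r (cl i j)"
  have b: "?b \<in> {1..n}" "cl 1 ?b = cl i j" using r_in cl_r cl_le[OF ij] by auto
  obtain \<sigma> where \<sigma>: "\<sigma> \<in> aut n E" "(\<sigma> 1 = i \<and> \<sigma> ?b = j) \<or> (\<sigma> 1 = j \<and> \<sigma> ?b = i)"
    using transitive[OF one_in b(1) ij b(2)] by blast
  then have "inj \<sigma>" by (auto simp: aut_def intro: permutes_inj)
  then have "var (inv \<sigma> i) (inv \<sigma> j) = var 1 ?b"
    using \<sigma>(2) inv_f_f[of \<sigma>] by (metis var_commute)
  then have "diff_form 1 ?b i j \<in> sym_forms n E"
    unfolding sym_forms_def diff_form_def using \<sigma>(1) ij by force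
  then show "diff_form 1 ?b i j \<in> lspan (sym_forms n E)" by (rule lspan_base)
qed

section \<open>Numbers of orbits and of eigenvalues\<close>

theorem num_orbits_eq: "num_orbits n E = D + 1"
proof -
  let ?C = "\<lambda>d. {{i, j} |i j. i \<in> {1..n} \<and> j \<in> {1..n} \<and> cl i j = d}"
  have orbit: "{\<sigma> ` {i, j} | \<sigma>. \<sigma> \<in> aut n E} = ?C (cl i j)"
    if ij: "i \<in> {1..n}" "j \<in> {1..n}" for i j
  proof (intro equalityI subsetI)
    fix q assume "q \<in> {\<sigma> ` {i, j} | \<sigma>. \<sigma> \<in> aut n E}"
    then obtain \<sigma> where "\<sigma> \<in> aut n E" "q = {\<sigma> i, \<sigma> j}" by auto
    then show "q \<in> ?C (cl i j)" using ij cl_aut aut_in_range by blast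
  next
    fix q assume "q \<in> ?C (cl i j)"
    then obtain i' j' where q: "q = {i', j'}" "i' \<in> {1..n}" "j' \<in> {1..n}" "cl i j = cl i' j'" by auto
    then obtain \<sigma> where \<sigma>: "\<sigma> \<in> aut n E" "(\<sigma> i = i' \<and> \<sigma> j = j') \<or> (\<sigma> i = j' \<and> \<sigma> j = i')"
      using transitive[OF ij] by blast
    then have "q = \<sigma> ` {i, j}" using q by auto
    then show "q \<in> {\<sigma> ` {i, j} | \<sigma>. \<sigma> \<in> aut n E}" using \<sigma> by blast
  qed
  have "{{\<sigma> ` p | \<sigma>. \<sigma> \<in> aut n E} | p. p \<in> upairs n} = ?C ` {..D}"
  proof (intro equalityI subsetI)
    fix x assume "x \<in> {{\<sigma> ` p | \<sigma>. \<sigma> \<in> aut n E} | p. p \<in> upairs n}"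
    then obtain i j where ij: "i \<in> {1..n}" "j \<in> {1..n}" "x = {\<sigma> ` {i, j} | \<sigma>. \<sigma> \<in> aut n E}"
      unfolding upairs_def by blast
    have "x = ?C (cl i j)" unfolding ij(3) by (rule orbit[OF ij(1,2)])
    then show "x \<in> ?C ` {..D}" using cl_le[OF ij(1,2)] by blast
  next
    fix x assume "x \<in> ?C ` {..D}"
    then obtain d where d: "d \<le> D" "x = ?C d" by auto
    then have "x = {\<sigma> ` {1, r d} | \<sigma>. \<sigma> \<in> aut n E}"
      using orbit[OF one_in r_in] cl_r by simp
    then show "x \<in> {{\<sigma> ` p | \<sigma>. \<sigma> \<in> aut n E} | p. p \<in> upairs n}"
      using one_in r_in[OF d(1)] unfolding upairs_def by blast
  qed
  \<comment> \<open>No class is empty, as \<open>{1, r d}\<close> lies in class \<open>d\<close>,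
    and symmetry of \<open>cl\<close> gives an unordered pair only one distance.\<close>
  moreover have "inj_on ?C {..D}"
  proof (rule inj_onI)
    fix d e assume de: "d \<in> {..D}" "e \<in> {..D}" "?C d = ?C e"
    have "{1, r d} \<in> ?C d" using one_in r_in[of d] cl_r[of d] de(1) by blast
    then obtain i j where ij: "{1, r d} = {i, j}" "i \<in> {1..n}" "j \<in> {1..n}" "cl i j = e"
      using de(3) by blast
    then have "cl 1 (r d) = e" using cl_commute by (auto simp: doubleton_eq_iff)
    then show "d = e" using cl_r de(1) by simp
  qed
  ultimately show ?thesis unfolding num_orbits_def by (simp add: card_image)
qed

text \<open>Walk counts, indexed by length and distance, form a triangular array with nonzero
  diagonal, so \<open>f\<close> is solved for from its largest distance downwards. The support bound
  \<open>k\<close> carries the induction; the application takes \<open>k = D\<close>.\<close>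

lemma class_function_in_span:
  fixes f :: "nat \<Rightarrow> complex"
  assumes "k \<le> D" "\<And>d. \<lbrakk>k < d; d \<le> D\<rbrakk> \<Longrightarrow> f d = 0"
  shows "\<exists>a. \<forall>i\<in>{1..n}. \<forall>j\<in>{1..n}. f (cl i j) = (\<Sum>l\<le>k. a l * of_nat (walks n E l i j))"
  using assms
proof (induction k arbitrary: f)
  case 0
  have "f (cl i j) = (\<Sum>l\<le>0. f 0 * of_nat (walks n E l i j))"
    if "i \<in> {1..n}" "j \<in> {1..n}" for i j
    using 0(2)[of "cl i j"] cl_le[OF that] cl_eq_0_iff[OF that] by auto
  then show ?case by (intro exI[of _ "\<lambda>_. f 0"] ballI)
next
  case (Suc k)
  let ?w = "\<lambda>d. of_nat (walks n E (Suc k) 1 (r d)) :: complex"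
  have w: "?w (Suc k) \<noteq> 0"
    using walks_cl_pos[OF one_in r_in cl_r, of "Suc k"] Suc.prems(1) by (simp del: walks.simps)
  \<comment> \<open>Chosen to cancel the value at distance \<open>Suc k\<close>; beyond it both
    \<open>f\<close> and the walk count vanish, so the remainder is supported on distances up to
    \<open>k\<close>.\<close>
  define b where "b = f (Suc k) / ?w (Suc k)"
  have "\<exists>a. \<forall>i\<in>{1..n}. \<forall>j\<in>{1..n}. f (cl i j) - b * ?w (cl i j) = (\<Sum>l\<le>k. a l * of_nat (walks n E l i j))"
  proof (rule Suc.IH)
    fix d assume d: "k < d" "d \<le> D"
    show "f d - b * ?w d = 0"
    proof (cases "d = Suc k")
      case True
      then show ?thesis using w by (simp add: b_def del: walks.simps)
    next
      case False
      then have "walks n E (Suc k) 1 (r d) = 0"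
        using d walks_eq_0 one_in r_in cl_r by (simp del: walks.simps)
      then show ?thesis using False d Suc.prems(2) by (simp del: walks.simps)
    qed
  qed (use Suc in simp)
  then obtain a where a: "\<And>i j. \<lbrakk>i \<in> {1..n}; j \<in> {1..n}\<rbrakk> \<Longrightarrow>
      f (cl i j) - b * ?w (cl i j) = (\<Sum>l\<le>k. a l * of_nat (walks n E l i j))" by blast
  have "f (cl i j) = (\<Sum>l\<le>Suc k. (a(Suc k := b)) l * of_nat (walks n E l i j))"
    if ij: "i \<in> {1..n}" "j \<in> {1..n}" for i j
  proof -
    have "walks n E (Suc k) 1 (r (cl i j)) = walks n E (Suc k) i j"
      using walks_cl[OF one_in r_in[OF cl_le[OF ij]] ij] cl_r[OF cl_le[OF ij]] by blast
    then have "f (cl i j) = (\<Sum>l\<le>k. a l * of_nat (walks n E l i j)) + (a(Suc k := b)) (Suc k) * of_nat (walks n E (Suc k) i j)"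
      using a[OF ij] by (simp add: diff_eq_eq del: walks.simps)
    also have "(\<Sum>l\<le>k. a l * of_nat (walks n E l i j)) = (\<Sum>l\<le>k. (a(Suc k := b)) l * of_nat (walks n E l i j))"
      by (intro sum.cong) auto
    finally show ?thesis by (simp only: sum.atMost_Suc)
  qed
  then show ?case by (intro exI[of _ "a(Suc k := b)"] ballI)
qed

text \<open>Since the powers up to \<open>D\<close> of the adjacency matrix span all class functions, the matrix
  satisfies a monic polynomial of degree \<open>D + 1\<close>.\<close>

lemma eigvals_bound: "finite (eigvals n E) \<and> card (eigvals n E) \<le> D + 1"
proof -
  obtain a where a: "\<And>i j. \<lbrakk>i \<in> {1..n}; j \<in> {1..n}\<rbrakk> \<Longrightarrow>
      of_nat (walks n E (Suc D) 1 (r (cl i j))) = (\<Sum>l\<le>D. a l * complex_of_nat (walks n E l i j))"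
    using class_function_in_span[OF order_refl, of "\<lambda>d. of_nat (walks n E (Suc D) 1 (r d))"] by auto
  \<comment> \<open>The relation with everything moved to one side; its leading coefficient
    \<open>-1\<close> is nonzero, as the bound on the number of roots requires.\<close>
  define c where "c = (\<lambda>l. if l = Suc D then - 1 else a l)"
  have c_Suc_D: "c (Suc D) = - 1" by (simp add: c_def)
  have walks_Suc_D: "of_nat (walks n E (Suc D) i j) = (\<Sum>l\<le>D. a l * complex_of_nat (walks n E l i j))"
    if ij: "i \<in> {1..n}" "j \<in> {1..n}" for i j
    using walks_cl[OF one_in r_in[OF cl_le[OF ij]] ij] cl_r[OF cl_le[OF ij]] a[OF ij] by metis
  have "eigvals n E \<subseteq> {z. (\<Sum>l\<le>Suc D. c l * z ^ l) = 0}"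
  proof
    fix \<mu> assume "\<mu> \<in> eigvals n E"
    then obtain v i where i: "i \<in> {1..n}" "v i \<noteq> 0"
      and v: "\<And>i. i \<in> {1..n} \<Longrightarrow> (\<Sum>j\<in>{1..n}. adj E i j * v j) = \<mu> * v i"
      unfolding eigvals_def by blast
    have "\<mu> ^ Suc D * v i = (\<Sum>j\<in>{1..n}. of_nat (walks n E (Suc D) i j) * v j)"
      using walks_eigvec[OF v i(1)] by metis
    also have "\<dots> = (\<Sum>j\<in>{1..n}. (\<Sum>l\<le>D. a l * complex_of_nat (walks n E l i j)) * v j)"
      using walks_Suc_D i by (intro sum.cong) (auto simp del: walks.simps)
    also have "\<dots> = (\<Sum>l\<le>D. a l * (\<Sum>j\<in>{1..n}. of_nat (walks n E l i j) * v j))"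
      unfolding sum_distrib_left sum_distrib_right by (subst sum.swap) (simp add: mult.assoc)
    also have "\<dots> = (\<Sum>l\<le>D. a l * \<mu> ^ l) * v i"
      using walks_eigvec[OF v i(1)] by (simp add: sum_distrib_right mult.assoc)
    finally have "\<mu> ^ Suc D = (\<Sum>l\<le>D. a l * \<mu> ^ l)" using i(2) by simp
    also have "(\<Sum>l\<le>D. a l * \<mu> ^ l) = (\<Sum>l\<le>D. c l * \<mu> ^ l)"
      by (intro sum.cong) (auto simp: c_def)
    finally show "\<mu> \<in> {z. (\<Sum>l\<le>Suc D. c l * z ^ l) = 0}" using c_Suc_D by simp
  qed
  moreover have "c (Suc D) \<noteq> 0" using c_Suc_D by simp
  ultimately show ?thesis
    using polyfun_rootbound[of c "Suc D" "Suc D"] finite_subset card_mono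
    by (metis (no_types, lifting) Suc_eq_plus1 le_trans order_refl)
qed

text \<open>\<open>D + 1\<close> distinct eigenvalues exhaust the upper bound. The index
  \<open>d\<close> merely enumerates; no link between \<open>ev d\<close> and distance
  \<open>d\<close> is intended.\<close>

theorem num_eigs_eq:
  assumes "inj_on ev {..D}" "\<And>d. d \<le> D \<Longrightarrow> ev d \<in> eigvals n E"
  shows "num_eigs n E = D + 1"
proof -
  have "card (ev ` {..D}) \<le> card (eigvals n E)"
    using eigvals_bound assms by (intro card_mono) auto
  then have "D + 1 \<le> card (eigvals n E)" using card_image[OF assms(1)] by simp
  then show ?thesis using eigvals_bound by (simp add: num_eigs_def eigvals_def)
qed

end

section \<open>The four families\<close>

lemma involution_permutes:
  assumes "\<And>x. \<sigma> (\<sigma> x) = x" "\<And>x. x \<in> S \<Longrightarrow> \<sigma> x \<in> S" "\<And>x. x \<notin> S \<Longrightarrow> \<sigma> x = x"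
  shows "\<sigma> permutes S"
  using assms by (intro bij_imp_permutes bij_betw_byWitness[of _ \<sigma>]) auto

lemma eigvalsI:
  assumes "\<And>i. i \<in> {1..n} \<Longrightarrow> (\<Sum>j\<in>{1..n}. adj E i j * v j) = \<mu> * v i" "i \<in> {1..n}" "v i \<noteq> 0"
  shows "\<mu> \<in> eigvals n E"
  using assms unfolding eigvals_def by blast

lemma transpose_in_range:
  assumes "a \<in> S" "b \<in> S" "i \<in> S"
  shows "transpose a b i \<in> S"
  using assms by (auto simp: transpose_def)

lemma sum_indicator:
  assumes "a \<in> {1..n::nat}"
  shows "(\<Sum>j\<in>{1..n}. if j = a then 1 else 0 :: complex) = 1"
  using assms by simp

subsection \<open>Cycles\<close>

text \<open>With truncated subtraction, \<open>(i - j) + (j - i)\<close> is the absolute difference.\<close>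

definition cycle_dist :: "nat \<Rightarrow> nat \<Rightarrow> nat \<Rightarrow> nat" where
  "cycle_dist n i j = min ((i - j) + (j - i)) (n - ((i - j) + (j - i)))"

lemma cycle_dist_le: "cycle_dist n i j \<le> n div 2"
  by (auto simp: cycle_dist_def)

lemma int_cycle_dist:
  assumes "i \<in> {1..n}" "j \<in> {1..n}"
  shows "int (cycle_dist n i j) = min \<bar>int i - int j\<bar> (int n - \<bar>int i - int j\<bar>)"
  using assms by (auto simp: cycle_dist_def)

text \<open>Along a shorter arc, one endpoint is reached from the other by \<open>cycle_dist\<close>
  forward steps; \<open>+ n\<close> accounts for passing from \<open>n\<close> to \<open>1\<close>.
  The direction is recorded because rotations preserve it.\<close>

lemma cycle_dist_cases:
  assumes "i \<in> {1..n}" "j \<in> {1..n}"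
  obtains "j = i + cycle_dist n i j \<or> j + n = i + cycle_dist n i j"
  | "i = j + cycle_dist n i j \<or> i + n = j + cycle_dist n i j"
proof -
  consider "i \<le> j" "2 * (j - i) \<le> n" | "i \<le> j" "n < 2 * (j - i)"
    | "j \<le> i" "2 * (i - j) \<le> n" | "j \<le> i" "n < 2 * (i - j)" by linarith
  then show thesis
  proof cases
    case 1
    then have "cycle_dist n i j = j - i" by (auto simp: cycle_dist_def)
    then show ?thesis using 1 by (intro that(1)) auto
  next
    case 2
    then have "cycle_dist n i j = n - (j - i)" by (auto simp: cycle_dist_def)
    then show ?thesis using 2 assms by (intro that(2)) auto
  next
    case 3
    then have "cycle_dist n i j = i - j" by (auto simp: cycle_dist_def)
    then show ?thesis using 3 by (intro that(2)) auto
  next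
    case 4
    then have "cycle_dist n i j = n - (i - j)" by (auto simp: cycle_dist_def)
    then show ?thesis using 4 assms by (intro that(1)) auto
  qed
qed

text \<open>The bound \<open>2 * d \<le> n\<close> makes the arc of length \<open>d\<close> a
  shortest one.\<close>

lemma cycle_dist_eqI:
  assumes "i \<in> {1..n}" "j \<in> {1..n}" "2 * d \<le> n"
    and "(j = i + d \<or> j + n = i + d) \<or> (i = j + d \<or> i + n = j + d)"
  shows "cycle_dist n i j = d"
  using assms(4) by (elim disjE) (use assms(1-3) in \<open>auto simp: cycle_dist_def min_def\<close>)

lemma cycle_graph_iff:
  assumes "i \<in> {1..n}" "j \<in> {1..n}" "3 \<le> n"
  shows "cycle_graph n i j \<longleftrightarrow> j = Suc i \<or> i = Suc j \<or> (i = n \<and> j = 1) \<or> (i = 1 \<and> j = n)"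
proof -
  have "k mod n = (if k = n then 0 else k)" if "k \<in> {1..n}" for k using that by auto
  then show ?thesis using assms by (auto simp: cycle_graph_def)
qed

definition rotate_cycle :: "nat \<Rightarrow> nat \<Rightarrow> nat \<Rightarrow> nat" where
  "rotate_cycle n t x = (if x \<in> {1..n} then if x + t \<le> n then x + t else x + t - n else x)"

text \<open>Modulo \<open>n\<close> the rotation preserves the forward gap \<open>d\<close> from
  \<open>i\<close> to \<open>j\<close>, and a residue determines a vertex of
  \<open>1..n\<close>.\<close>

lemma rotate_cycle_shift:
  assumes "t < n" "i \<in> {1..n}" "j \<in> {1..n}" "i' \<in> {1..n}" "j' \<in> {1..n}"
    and "rotate_cycle n t i = i'"
    and "j = i + d \<or> j + n = i + d" "j' = i' + d \<or> j' + n = i' + d"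
  shows "rotate_cycle n t j = j'"
proof -
  have "i + t = i' \<or> i + t = i' + n"
    using assms(1,2,4,6) by (auto simp: rotate_cycle_def split: if_splits)
  then have "j + t = j' \<or> j + t = j' + n"
    using assms(7,8) by (elim disjE) (use assms(1-5) in simp_all)
  then show ?thesis using assms(3,5) by (auto simp: rotate_cycle_def)
qed

lemma rotate_cycle_shift_rev:
  assumes "t < n" "i \<in> {1..n}" "j \<in> {1..n}" "i' \<in> {1..n}" "j' \<in> {1..n}"
    and "rotate_cycle n t i = i'"
    and "i = j + d \<or> i + n = j + d" "i' = j' + d \<or> i' + n = j' + d"
  shows "rotate_cycle n t j = j'"
proof -
  have "i + t = i' \<or> i + t = i' + n"
    using assms(1,2,4,6) by (auto simp: rotate_cycle_def split: if_splits)
  then have "j + t = j' \<or> j + t = j' + n"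
    using assms(7,8) by (elim disjE) (use assms(1-5) in simp_all)
  then show ?thesis using assms(3,5) by (auto simp: rotate_cycle_def)
qed

lemma rotate_cycle_in_aut:
  assumes "3 \<le> n" "t < n"
  shows "rotate_cycle n t \<in> aut n (cycle_graph n)"
proof -
  have p: "rotate_cycle n t permutes {1..n}"
  proof (rule bij_imp_permutes)
    show "bij_betw (rotate_cycle n t) {1..n} {1..n}"
      using assms by (intro bij_betw_byWitness[of _ "\<lambda>x. if t < x then x - t else x + n - t"])
        (auto simp: rotate_cycle_def)
  qed (auto simp: rotate_cycle_def)
  have "cycle_graph n (rotate_cycle n t i) (rotate_cycle n t j) = cycle_graph n i j"
    if ij: "i \<in> {1..n}" "j \<in> {1..n}" for i j
  proof -
    have "rotate_cycle n t i \<in> {1..n}" "rotate_cycle n t j \<in> {1..n}"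
      using permutes_in_image[OF p] ij by auto
    then show ?thesis using ij assms
      by (simp only: cycle_graph_iff) (auto simp: rotate_cycle_def)
  qed
  then show ?thesis using p by (simp add: aut_def)
qed

lemma cycle_distance_transitive:
  assumes n: "3 \<le> n"
  shows "distance_transitive_graph n (cycle_graph n) (cycle_dist n) (n div 2) Suc"
proof
  fix i j assume ij: "i \<in> {1..n}" "j \<in> {1..n}"
  show "cycle_graph n j i" if "cycle_graph n i j"
    using that by (auto simp: cycle_graph_def)
  show "cycle_dist n i j = cycle_dist n j i" by (simp add: cycle_dist_def add.commute)
  show "cycle_dist n i j = 0 \<longleftrightarrow> i = j" using ij by (auto simp: cycle_dist_def min_def)
  show "cycle_dist n i j \<le> n div 2" by (rule cycle_dist_le)
  show "\<exists>k\<in>{1..n}. cycle_graph n k j \<and> cycle_dist n i k = d" if d: "cycle_dist n i j = Suc d" for d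
  proof -
    \<comment> \<open>The two neighbours of \<open>j\<close>. The step back towards \<open>i\<close>
      lands on \<open>p\<close> if the shorter arc runs forward from \<open>i\<close>, and on
      \<open>s\<close> if it runs forward from \<open>j\<close>.\<close>
    define s where "s = (if j = n then 1 else Suc j)"
    define p where "p = (if j = 1 then n else j - 1)"
    have sp: "s \<in> {1..n}" "p \<in> {1..n}" using ij by (auto simp: s_def p_def)
    have "cycle_graph n s j" "cycle_graph n p j"
      unfolding cycle_graph_iff[OF sp(1) ij(2) n] cycle_graph_iff[OF sp(2) ij(2) n]
      using ij by (auto simp: s_def p_def)
    moreover have "cycle_dist n i s = d \<or> cycle_dist n i p = d"
    proof -
      have d2: "2 * d \<le> n" using cycle_dist_le[of n i j] d by linarith
      show ?thesis using ij
      proof (cases rule: cycle_dist_cases)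
        case 1
        then have "p = i + d \<or> p + n = i + d" using ij d by (auto simp: p_def)
        then show ?thesis using cycle_dist_eqI[OF ij(1) sp(2) d2] by blast
      next
        case 2
        then have "i = s + d \<or> i + n = s + d" using ij d by (auto simp: s_def)
        then show ?thesis using cycle_dist_eqI[OF ij(1) sp(1) d2] by blast
      qed
    qed
    ultimately show ?thesis using sp by blast
  qed
  show "cycle_dist n i k \<le> Suc (cycle_dist n i j)" if "k \<in> {1..n}" "cycle_graph n j k" for k
  proof -
    have "k = Suc j \<or> j = Suc k \<or> (j = n \<and> k = 1) \<or> (j = 1 \<and> k = n)"
      using that(2) unfolding cycle_graph_iff[OF ij(2) that(1) n] .
    then show ?thesis
      using int_cycle_dist[OF ij] int_cycle_dist[OF ij(1) that(1)] ij that(1)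
      by (auto simp: min_def abs_if split: if_splits)
  qed
  show "\<exists>\<sigma>\<in>aut n (cycle_graph n). (\<sigma> i = i' \<and> \<sigma> j = j') \<or> (\<sigma> i = j' \<and> \<sigma> j = i')"
    if ij': "i' \<in> {1..n}" "j' \<in> {1..n}" and eq: "cycle_dist n i j = cycle_dist n i' j'" for i' j'
  proof -
    have rot: "\<exists>t<n. rotate_cycle n t i = k" if "k \<in> {1..n}" for k
      by (rule exI[of _ "if i \<le> k then k - i else k + n - i"])
        (use ij that in \<open>auto simp: rotate_cycle_def\<close>)
    obtain t where t: "t < n" "rotate_cycle n t i = i'" using rot ij' by blast
    obtain u where u: "u < n" "rotate_cycle n u i = j'" using rot ij' by blast
    \<comment> \<open>If the two arcs are oriented alike, \<open>i\<close> goes to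
      \<open>i'\<close>; otherwise \<open>i\<close> goes to \<open>j'\<close> and \<open>j\<close>
      to \<open>i'\<close>. Reflections never enter.\<close>
    have "rotate_cycle n t j = j' \<or> rotate_cycle n u j = i'"
      using ij
    proof (cases rule: cycle_dist_cases)
      case 1
      note eq1 = 1[unfolded eq]
      show ?thesis using ij'
      proof (cases rule: cycle_dist_cases)
        case 1
        then show ?thesis using rotate_cycle_shift[OF t(1) ij ij' t(2) eq1] by blast
      next
        case 2
        then show ?thesis using rotate_cycle_shift[OF u(1) ij ij'(2,1) u(2) eq1] by blast
      qed
    next
      case 2
      note eq2 = 2[unfolded eq]
      show ?thesis using ij'
      proof (cases rule: cycle_dist_cases)
        case 1
        then show ?thesis using rotate_cycle_shift_rev[OF u(1) ij ij'(2,1) u(2) eq2] by blast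
      next
        case 2
        then show ?thesis using rotate_cycle_shift_rev[OF t(1) ij ij' t(2) eq2] by blast
      qed
    qed
    then show ?thesis using t u rotate_cycle_in_aut[OF n] by blast
  qed
next
  fix d assume "d \<le> n div 2"
  then show "Suc d \<in> {1..n}" "cycle_dist n 1 (Suc d) = d"
    using n by (auto simp: cycle_dist_def)
qed (use n in simp)

lemma cycle_lin_forms:
  assumes n: "3 \<le> n"
  shows "lin_forms n (cycle_graph n) = lspan (cycle_gens n)"
proof -
  interpret distance_transitive_graph n "cycle_graph n" "cycle_dist n" "n div 2" Suc
    by (rule cycle_distance_transitive[OF n])
  \<comment> \<open>One subtraction of \<open>n\<close> is enough, since
    \<open>i + d \<le> n + n div 2 < 2 * n\<close>.\<close>
  have wrap: "wrap n (i + d) = (if i + d \<le> n then i + d else i + d - n)"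
    if "i \<in> {1..n}" "d \<le> n div 2" for i d
  proof -
    have "(i + d - 1) mod n = (if i + d \<le> n then i + d - 1 else i + d - 1 - n)"
      using that by (cases "i + d \<le> n") (auto simp: le_mod_geq)
    then show ?thesis using that unfolding wrap_def by auto
  qed
  show ?thesis
  proof (rule lin_forms_eq_lspan)
    fix g assume "g \<in> cycle_gens n"
    then obtain i d where id: "i \<in> {2..n}" "d \<le> n div 2"
      and g: "g = diff_form 1 (wrap n (1 + d)) i (wrap n (i + d))"
      unfolding cycle_gens_def by auto
    have "i \<in> {1..n}" "wrap n (1 + d) \<in> {1..n}" "wrap n (i + d) \<in> {1..n}"
      using id n wrap[OF one_in id(2)] wrap[of i, OF _ id(2)] by auto
    moreover from this have "cycle_dist n 1 (wrap n (1 + d)) = d" "cycle_dist n i (wrap n (i + d)) = d"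
      using id wrap[OF one_in id(2)] wrap[of i, OF _ id(2)] one_in by (intro cycle_dist_eqI; auto)+
    ultimately show "g \<in> distance_forms"
      unfolding g using one_in by (intro distance_formsI) auto
  next
    fix i j assume ij: "i \<in> {1..n}" "j \<in> {1..n}"
    define d where "d = cycle_dist n i j"
    have d: "d \<le> n div 2" using cl_le[OF ij] by (simp add: d_def)
    then have Suc_d: "Suc d = wrap n (1 + d)" using wrap[OF one_in d] n by auto
    \<comment> \<open>For \<open>k = 1\<close> the form is zero, which is why the generators can
      start at \<open>i = 2\<close>.\<close>
    have *: "diff_form 1 (Suc d) k (wrap n (k + d)) \<in> lspan (cycle_gens n)" if k: "k \<in> {1..n}" for k
    proof (cases "k = 1")
      case True
      then show ?thesis using Suc_d lspan_zero by (simp add: diff_form_def)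
    next
      case False
      then have "k \<in> {2..n}" "d \<in> {0..n div 2}" using k d by auto
      then show ?thesis unfolding Suc_d cycle_gens_def by (intro lspan_base) blast
    qed
    \<comment> \<open>The generators only move forward from their first index; when the arc runs
      forward from \<open>j\<close>, symmetry of the form exchanges the endpoints.\<close>
    have "j = wrap n (i + d) \<or> i = wrap n (j + d)"
      using ij
      by (cases rule: cycle_dist_cases)
        (use ij in \<open>auto simp: wrap[OF ij(1) d] wrap[OF ij(2) d] simp flip: d_def\<close>)
    then show "diff_form 1 (Suc (cycle_dist n i j)) i j \<in> lspan (cycle_gens n)"
      using *[OF ij(1)] *[OF ij(2)] diff_form_commute unfolding d_def by metis
  qed
qed

text \<open>For an \<open>n\<close>-th root of unity \<open>w\<close>, the vector
  \<open>w ^ i\<close> is scaled by \<open>w\<close> and \<open>inverse w\<close> under the two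
  cyclic shifts whose sum is the adjacency matrix; \<open>w ^ n = 1\<close> covers the
  wraparound.\<close>

lemma cycle_eigvals:
  assumes n: "3 \<le> n"
  shows "cis (2 * pi * real d / n) + inverse (cis (2 * pi * real d / n)) \<in> eigvals n (cycle_graph n)"
proof -
  define w where "w = cis (2 * pi * real d / n)"
  have w0: "w \<noteq> 0" by (simp add: w_def)
  have "w ^ n = cis (2 * pi * real d)" using n by (simp add: w_def DeMoivre)
  also have "\<dots> = 1" using cis_multiple_2pi[of "real d"] by simp
  finally have wn: "w ^ n = 1" .
  have "w + inverse w \<in> eigvals n (cycle_graph n)"
  proof (rule eigvalsI)
    fix i assume i: "i \<in> {1..n}"
    define s where "s = (if i = n then 1 else Suc i)"
    define p where "p = (if i = 1 then n else i - 1)"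
    have sp: "s \<in> {1..n}" "p \<in> {1..n}" "s \<noteq> p" using i n by (auto simp: s_def p_def)
    have "(\<Sum>j\<in>{1..n}. adj (cycle_graph n) i j * w ^ j) = (\<Sum>j\<in>{s, p}. w ^ j)"
    proof (rule sum.mono_neutral_cong_right)
      have iff: "cycle_graph n i j \<longleftrightarrow> j \<in> {s, p}" if j: "j \<in> {1..n}" for j
        unfolding cycle_graph_iff[OF i j n] using i j n by (auto simp: s_def p_def)
      show "\<forall>j\<in>{1..n} - {s, p}. adj (cycle_graph n) i j * w ^ j = 0" using iff by (simp add: adj_def)
      show "adj (cycle_graph n) i j * w ^ j = w ^ j" if "j \<in> {s, p}" for j
        using iff[of j] that sp by (auto simp: adj_def)
    qed (use sp in auto)
    also have "\<dots> = w ^ s + w ^ p" using sp by simp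
    also have "w ^ s = w * w ^ i" using wn by (simp add: s_def)
    also have "w ^ p = inverse w * w ^ i"
    proof -
      have "w ^ i = w * w ^ p" using i wn by (cases i) (auto simp: p_def)
      then show ?thesis using w0 by simp
    qed
    finally show "(\<Sum>j\<in>{1..n}. adj (cycle_graph n) i j * w ^ j) = (w + inverse w) * w ^ i"
      by (simp add: distrib_right)
  qed (use n w0 in auto)
  then show ?thesis by (simp add: w_def)
qed

text \<open>The values are \<open>2 * cos (2 * pi * d / n)\<close>, and
  \<open>d \<le> n div 2\<close> keeps the angle between \<open>0\<close> and \<open>pi\<close>,
  where the cosine is injective.\<close>

lemma cycle_eigvals_inj:
  assumes n: "3 \<le> n"
  shows "inj_on (\<lambda>d. cis (2 * pi * real d / n) + inverse (cis (2 * pi * real d / n))) {..n div 2}"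
proof (rule inj_onI)
  fix d e assume d: "d \<in> {..n div 2}" and e: "e \<in> {..n div 2}"
    and eq: "cis (2 * pi * real d / n) + inverse (cis (2 * pi * real d / n))
      = cis (2 * pi * real e / n) + inverse (cis (2 * pi * real e / n))"
  have cos_eq: "cos (2 * pi * real d / n) = cos (2 * pi * real e / n)"
    using arg_cong[OF eq, of Re] by simp
  have le_pi: "2 * pi * real k / n \<le> pi" if "k \<in> {..n div 2}" for k
  proof -
    have "2 * real k \<le> n" using that by (simp add: of_nat_mult[symmetric] del: of_nat_mult)
    then show ?thesis using n by (simp add: field_simps)
  qed
  have "2 * pi * real d / n = 2 * pi * real e / n"
    by (rule cos_inj_pi[OF _ le_pi[OF d] _ le_pi[OF e] cos_eq]) simp_all
  then show "d = e" using n by simp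
qed

subsection \<open>Complete graphs\<close>

text \<open>Transpositions do both jobs: \<open>transpose i i'\<close> moves a vertex, and
  \<open>transpose j j'\<close> fixes any \<open>i\<close> equally far from \<open>j\<close> and
  \<open>j'\<close>.\<close>

lemma complete_distance_transitive:
  assumes n: "2 \<le> n"
  shows "distance_transitive_graph n (complete_graph n) (\<lambda>i j. if i = j then 0 else 1) 1 Suc"
proof -
  interpret distance_graph n "complete_graph n" "\<lambda>i j. if i = j then 0 else 1" 1 Suc
    using n by unfold_locales (auto simp: complete_graph_def split: if_splits)
  have tr: "transpose a b \<in> aut n (complete_graph n)" if "a \<in> {1..n}" "b \<in> {1..n}" for a b
    using permutes_swap_id[OF that] transpose_in_range[OF that]
    by (auto simp: aut_def complete_graph_def simp del: atLeastAtMost_iff dest: inj_onD[OF inj_on_transpose[of a b UNIV]])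
  show ?thesis
  proof
    fix i j i' j' assume "i \<in> {1..n}" "j \<in> {1..n}" "i' \<in> {1..n}" "j' \<in> {1..n}"
      "(if i = j then 0 else 1::nat) = (if i' = j' then 0 else 1)"
    then have "\<exists>\<sigma>\<in>aut n (complete_graph n). \<sigma> i = i' \<and> \<sigma> j = j'"
    proof (rule transitive_if[rotated 2])
      fix i i' assume "i \<in> {1..n}" "i' \<in> {1..n}"
      then show "\<exists>\<sigma>\<in>aut n (complete_graph n). \<sigma> i = i'"
        using tr by (intro bexI[of _ "transpose i i'"]) auto
    next
      fix i j j' assume j: "j \<in> {1..n}" "j' \<in> {1..n}"
        and eq: "(if i = j then 0 else 1::nat) = (if i = j' then 0 else 1)"
      have "transpose j j' i = i" using eq by (auto simp: transpose_def split: if_splits)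
      then show "\<exists>\<sigma>\<in>aut n (complete_graph n). \<sigma> i = i \<and> \<sigma> j = j'"
        by (intro bexI[of _ "transpose j j'"] conjI transpose_apply_first tr[OF j])
    qed
    then show "\<exists>\<sigma>\<in>aut n (complete_graph n). (\<sigma> i = i' \<and> \<sigma> j = j') \<or> (\<sigma> i = j' \<and> \<sigma> j = i')" by blast
  qed
qed

lemma complete_lin_forms:
  assumes n: "2 \<le> n"
  shows "lin_forms n (complete_graph n) = lspan (complete_gens n)"
proof -
  interpret distance_transitive_graph n "complete_graph n" "\<lambda>i j. if i = j then 0 else 1" 1 Suc
    by (rule complete_distance_transitive[OF n])
  show ?thesis
  proof (rule lin_forms_eq_lspan)
    fix g assume "g \<in> complete_gens n"
    then consider i where "i \<in> {1..n}" "g = diff_form 1 1 i i"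
      | i j where "complete_graph n i j" "g = diff_form 1 2 i j"
      unfolding complete_gens_def by blast
    then show "g \<in> distance_forms"
    proof cases
      case (1 i)
      then show ?thesis using one_in unfolding 1(2) by (intro distance_formsI) auto
    next
      case (2 i j)
      then have "i \<in> {1..n}" "j \<in> {1..n}" "i \<noteq> j" by (auto simp: complete_graph_def)
      then show ?thesis unfolding 2(2) using n by (intro distance_formsI) auto
    qed
  next
    fix i j assume "i \<in> {1..n}" "j \<in> {1..n}"
    then have "diff_form 1 (Suc (if i = j then 0 else 1)) i j \<in> complete_gens n"
      by (auto simp: complete_gens_def complete_graph_def numeral_2_eq_2)
    then show "diff_form 1 (Suc (if i = j then 0 else 1)) i j \<in> lspan (complete_gens n)"
      by (rule lspan_base)
  qed
qed

text \<open>The adjacency matrix is the all-ones matrix minus the identity: it scales constants by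
  \<open>n - 1\<close> and vectors of sum zero by \<open>-1\<close>.\<close>

lemma complete_eigvals:
  assumes n: "2 \<le> n"
  shows "of_nat n - 1 \<in> eigvals n (complete_graph n)" "-1 \<in> eigvals n (complete_graph n)"
proof -
  have row: "(\<Sum>j\<in>{1..n}. adj (complete_graph n) i j * v j) = (\<Sum>j\<in>{1..n}. v j) - v i"
    if "i \<in> {1..n}" for i v
  proof -
    have "(\<Sum>j\<in>{1..n}. adj (complete_graph n) i j * v j) = (\<Sum>j\<in>{1..n}. v j - (if j = i then v j else 0))"
      using that by (intro sum.cong) (auto simp: adj_def complete_graph_def)
    then show ?thesis using that by (simp add: sum_subtractf)
  qed
  show "of_nat n - 1 \<in> eigvals n (complete_graph n)"
    using row[of _ "\<lambda>_. 1"] n by (intro eigvalsI[of _ _ "\<lambda>_. 1" _ 1]) auto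
  let ?v = "\<lambda>j. (if j = 1 then 1 else 0) - (if j = 2 then 1 else 0) :: complex"
  have "(\<Sum>j\<in>{1..n}. ?v j) = 0"
    using n unfolding sum_subtractf by (subst (1 2) sum_indicator) auto
  then show "-1 \<in> eigvals n (complete_graph n)"
    using row[of _ ?v] n by (intro eigvalsI[of _ _ ?v _ 1]) auto
qed

subsection \<open>Complete bipartite graphs\<close>

text \<open>The matching of \<open>2k - 1\<close> with \<open>2k\<close>. It exchanges the sides of
  the bipartite graph and names the unique non-neighbour of a vertex in the hyperoctahedral
  graph.\<close>

definition partner :: "nat \<Rightarrow> nat" where
  "partner x = (if odd x then x + 1 else x - 1)"

lemma partner_in: "x \<in> {1..2*m} \<Longrightarrow> partner x \<in> {1..2*m}"
  unfolding partner_def by (auto; presburger)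

lemma partner_partner: "x \<in> {1..2*m} \<Longrightarrow> partner (partner x) = x"
  unfolding partner_def by auto

lemma even_partner: "x \<in> {1..2*m} \<Longrightarrow> even (partner x) \<longleftrightarrow> odd x"
  unfolding partner_def by auto

definition bip_dist :: "nat \<Rightarrow> nat \<Rightarrow> nat" where
  "bip_dist i j = (if i = j then 0 else if odd i \<noteq> odd j then 1 else 2)"

lemma bip_distance_transitive:
  assumes m: "2 \<le> m"
  shows "distance_transitive_graph (2*m) (complete_bip m) bip_dist 2 Suc"
proof -
  interpret distance_graph "2*m" "complete_bip m" bip_dist 2 Suc
  proof
    fix i j d assume ij: "i \<in> {1..2*m}" "j \<in> {1..2*m}" "bip_dist i j = Suc d"
    show "\<exists>k\<in>{1..2*m}. complete_bip m k j \<and> bip_dist i k = d"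
    proof (cases "odd i = odd j")
      case True
      then show ?thesis using ij partner_in[OF ij(1)] even_partner[OF ij(1)]
        by (intro bexI[of _ "partner i"]) (auto simp: bip_dist_def complete_bip_def split: if_splits)
    next
      case False
      then show ?thesis using ij
        by (intro bexI[of _ i]) (auto simp: bip_dist_def complete_bip_def split: if_splits)
    qed
  next
    fix d :: nat assume "d \<le> 2"
    then have "d = 0 \<or> d = 1 \<or> d = 2" by auto
    then show "Suc d \<in> {1..2*m}" "bip_dist 1 (Suc d) = d" using m by (auto simp: bip_dist_def)
  qed (use m in \<open>auto simp: bip_dist_def complete_bip_def\<close>)
  have tr: "transpose a b \<in> aut (2*m) (complete_bip m)"
    if ab: "a \<in> {1..2*m}" "b \<in> {1..2*m}" and "odd a = odd b" for a b
  proof -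
    have "odd (transpose a b x) = odd x" for x using that by (auto simp: transpose_def)
    then show ?thesis using permutes_swap_id[OF ab] transpose_in_range[OF ab]
      by (auto simp: aut_def complete_bip_def simp del: atLeastAtMost_iff One_nat_def)
  qed
  \<comment> \<open>Transpositions within a side never exchange the sides; this involution
    does.\<close>
  define sw where "sw = (\<lambda>x. if x \<in> {1..2*m} then partner x else x)"
  have sw: "sw \<in> aut (2*m) (complete_bip m)"
  proof -
    have "sw permutes {1..2*m}"
      by (rule involution_permutes) (auto simp: sw_def partner_in partner_partner simp del: atLeastAtMost_iff One_nat_def)
    then show ?thesis
      by (auto simp: aut_def complete_bip_def sw_def partner_in even_partner simp del: atLeastAtMost_iff One_nat_def)
  qed
  show ?thesis
  proof
    fix i j i' j' assume "i \<in> {1..2*m}" "j \<in> {1..2*m}" "i' \<in> {1..2*m}" "j' \<in> {1..2*m}"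
      "bip_dist i j = bip_dist i' j'"
    then have "\<exists>\<sigma>\<in>aut (2*m) (complete_bip m). \<sigma> i = i' \<and> \<sigma> j = j'"
    proof (rule transitive_if[rotated 2])
      fix i i' assume i: "i \<in> {1..2*m}" "i' \<in> {1..2*m}"
      show "\<exists>\<sigma>\<in>aut (2*m) (complete_bip m). \<sigma> i = i'"
      proof (cases "odd i = odd i'")
        case True
        then show ?thesis using tr[OF i] by (intro bexI[of _ "transpose i i'"]) auto
      next
        case False
        \<comment> \<open>\<open>sw\<close> brings \<open>i\<close> to the side of
          \<open>i'\<close>, and a transposition within that side corrects the target.\<close>
        then have "transpose (partner i) i' \<circ> sw \<in> aut (2*m) (complete_bip m)"
          using i by (intro aut_comp sw tr) (auto simp: partner_in even_partner simp del: atLeastAtMost_iff One_nat_def)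
        then show ?thesis using i by (intro bexI[of _ "transpose (partner i) i' \<circ> sw"]) (auto simp: sw_def)
      qed
    next
      fix i j j' assume j: "j \<in> {1..2*m}" "j' \<in> {1..2*m}" and eq: "bip_dist i j = bip_dist i j'"
      \<comment> \<open>Equal distances from \<open>i\<close> put \<open>j\<close> and
        \<open>j'\<close> on the same side, and either both or neither equal
        \<open>i\<close>.\<close>
      have "transpose j j' i = i" "odd j = odd j'"
        using eq by (auto simp: transpose_def bip_dist_def split: if_splits)
      then show "\<exists>\<sigma>\<in>aut (2*m) (complete_bip m). \<sigma> i = i \<and> \<sigma> j = j'"
        by (intro bexI[of _ "transpose j j'"] conjI transpose_apply_first tr[OF j])
    qed
    then show "\<exists>\<sigma>\<in>aut (2*m) (complete_bip m). (\<sigma> i = i' \<and> \<sigma> j = j') \<or> (\<sigma> i = j' \<and> \<sigma> j = i')"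
      by blast
  qed
qed

lemma bip_lin_forms:
  assumes m: "2 \<le> m"
  shows "lin_forms (2*m) (complete_bip m) = lspan (bip_gens m)"
proof -
  interpret distance_transitive_graph "2*m" "complete_bip m" bip_dist 2 Suc
    by (rule bip_distance_transitive[OF m])
  have 123: "1 \<in> {1..2*m}" "2 \<in> {1..2*m}" "3 \<in> {1..2*m}" using m by auto
  show ?thesis
  proof (rule lin_forms_eq_lspan)
    fix g assume "g \<in> bip_gens m"
    then consider i where "i \<in> {1..2*m}" "g = diff_form 1 1 i i"
      | i j where "complete_bip m i j" "g = diff_form 1 2 i j"
      | i j where "i \<in> {1..2*m}" "j \<in> {1..2*m}" "i \<noteq> j" "\<not> complete_bip m i j" "g = diff_form 1 3 i j"
      unfolding bip_gens_def by blast
    then show "g \<in> distance_forms"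
    proof cases
      case (1 i)
      moreover have "bip_dist 1 1 = bip_dist i i" by (simp add: bip_dist_def)
      ultimately show ?thesis using 123 by (simp only: distance_formsI)
    next
      case (2 i j)
      then have "bip_dist 1 2 = bip_dist i j" "i \<in> {1..2*m}" "j \<in> {1..2*m}"
        by (auto simp: bip_dist_def complete_bip_def)
      then show ?thesis using 123 unfolding 2(2) by (intro distance_formsI)
    next
      case (3 i j)
      then have "bip_dist 1 3 = bip_dist i j" by (auto simp: bip_dist_def complete_bip_def)
      then show ?thesis using 123 3(1,2) unfolding 3(5) by (intro distance_formsI)
    qed
  next
    fix i j assume "i \<in> {1..2*m}" "j \<in> {1..2*m}"
    then have "diff_form 1 (Suc (bip_dist i j)) i j \<in> bip_gens m"
      unfolding bip_gens_def bip_dist_def complete_bip_def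
      by (cases "i = j"; cases "odd i = odd j") (auto simp: numeral_2_eq_2 numeral_3_eq_3)
    then show "diff_form 1 (Suc (bip_dist i j)) i j \<in> lspan (bip_gens m)"
      by (rule lspan_base)
  qed
qed

lemma sum_parity: "(\<Sum>j\<in>{1..2*m}. if odd j then a else b) = of_nat m * (a + b :: complex)"
  by (induction m) (auto simp: algebra_simps)

text \<open>Eigenvectors: constants, opposite signs on the two sides, and the difference of the unit
  vectors at \<open>1\<close> and \<open>3\<close>, two vertices of the same side.\<close>

lemma bip_eigvals:
  assumes m: "2 \<le> m"
  shows "of_nat m \<in> eigvals (2*m) (complete_bip m)" "- of_nat m \<in> eigvals (2*m) (complete_bip m)"
    "0 \<in> eigvals (2*m) (complete_bip m)"
proof -
  have row: "(\<Sum>j\<in>{1..2*m}. adj (complete_bip m) i j * v j)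
      = (\<Sum>j\<in>{1..2*m}. if odd j then if odd i then 0 else v j else if odd i then v j else 0)"
    if "i \<in> {1..2*m}" for i v
    using that by (intro sum.cong) (auto simp: adj_def complete_bip_def)
  show "of_nat m \<in> eigvals (2*m) (complete_bip m)"
  proof (rule eigvalsI)
    fix i assume i: "i \<in> {1..2*m}"
    show "(\<Sum>j\<in>{1..2*m}. adj (complete_bip m) i j * 1) = of_nat m * 1"
      unfolding row[OF i, of "\<lambda>_. 1"] sum_parity by simp
  qed (use m in auto)
  show "- of_nat m \<in> eigvals (2*m) (complete_bip m)"
  proof (rule eigvalsI)
    fix i assume i: "i \<in> {1..2*m}"
    have "(\<Sum>j\<in>{1..2*m}. adj (complete_bip m) i j * (if odd j then 1 else -1))
        = (\<Sum>j\<in>{1..2*m}. if odd j then if odd i then 0 else 1 else if odd i then -1 else 0)"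
      unfolding row[OF i, of "\<lambda>j. if odd j then 1 else -1"] by (intro sum.cong) auto
    then show "(\<Sum>j\<in>{1..2*m}. adj (complete_bip m) i j * (if odd j then 1 else -1))
        = - of_nat m * (if odd i then 1 else -1)"
      unfolding sum_parity by simp
  qed (use m in \<open>auto intro!: exI[of _ 1]\<close>)
  show "0 \<in> eigvals (2*m) (complete_bip m)"
  proof (rule eigvalsI)
    let ?v = "\<lambda>j. (if j = 1 then 1 else 0) - (if j = 3 then 1 else 0) :: complex"
    fix i assume i: "i \<in> {1..2*m}"
    have "(\<Sum>j\<in>{1..2*m}. adj (complete_bip m) i j * ?v j)
        = (\<Sum>j\<in>{1..2*m}. (if odd i then 0 else 1) * ?v j)"
      using i by (intro sum.cong) (auto simp: adj_def complete_bip_def)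
    also have "(\<Sum>j\<in>{1..2*m}. (if odd i then 0 else 1) * ?v j) = (if odd i then 0 else 1) * (\<Sum>j\<in>{1..2*m}. ?v j)"
      by (rule sum_distrib_left[symmetric])
    also have "(\<Sum>j\<in>{1..2*m}. ?v j) = 0"
      using m unfolding sum_subtractf by (subst (1 2) sum_indicator) auto
    finally show "(\<Sum>j\<in>{1..2*m}. adj (complete_bip m) i j * ?v j) = 0 * ?v i" by simp
  next
    show "1 \<in> {1..2*m}" using m by simp
  qed auto
qed

subsection \<open>Hyperoctahedral graphs\<close>

text \<open>\<open>(i + 1) div 2\<close> is the index \<open>k\<close> of the pair
  \<open>2k - 1\<close>, \<open>2k\<close> containing \<open>i\<close>.\<close>

lemma hyperoct_iff:
  assumes "i \<in> {1..2*m}" "j \<in> {1..2*m}"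
  shows "hyperoct m i j \<longleftrightarrow> i \<noteq> j \<and> j \<noteq> partner i"
proof -
  have "(i + 1) div 2 = (j + 1) div 2 \<longleftrightarrow> i = j \<or> j = partner i"
    using assms unfolding partner_def by (auto; presburger)
  then show ?thesis using assms by (auto simp: hyperoct_def)
qed

definition hyperoct_dist :: "nat \<Rightarrow> nat \<Rightarrow> nat" where
  "hyperoct_dist i j = (if i = j then 0 else if j = partner i then 2 else 1)"

text \<open>Vertex \<open>2\<close> is the partner of \<open>1\<close>, hence at distance 2, and
  \<open>3\<close> is adjacent to \<open>1\<close>; so \<open>Suc\<close> cannot provide the
  representatives here.\<close>

definition hyperoct_rep :: "nat \<Rightarrow> nat" where
  "hyperoct_rep d = (if d = 0 then 1 else if d = 1 then 3 else 2)"

text \<open>Exchanges \<open>a\<close> with \<open>b\<close> and the partner of \<open>a\<close> with that of \<open>b\<close>; for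
  \<open>b = partner a\<close> the first two clauses take precedence and it is a transposition.\<close>

definition pair_swap :: "nat \<Rightarrow> nat \<Rightarrow> nat \<Rightarrow> nat" where
  "pair_swap a b x = (if x = a then b else if x = b then a else
      if x = partner a then partner b else if x = partner b then partner a else x)"

text \<open>Adjacency is expressed by equality and \<open>partner\<close> alone, so a permutation
  commuting with \<open>partner\<close> is an automorphism.\<close>

lemma pair_swap_in_aut:
  assumes a: "a \<in> {1..2*m}" and b: "b \<in> {1..2*m}"
  shows "pair_swap a b \<in> aut (2*m) (hyperoct m)"
proof -
  have inj: "partner x = partner y \<longleftrightarrow> x = y" if "x \<in> {1..2*m}" "y \<in> {1..2*m}" for x y
    using that partner_partner by metis
  have neq: "partner x \<noteq> x" if "x \<in> {1..2*m}" for x using that by (auto simp: partner_def)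
  note pa = partner_partner[OF a] partner_partner[OF b] neq[OF a] neq[OF b] inj[OF a b]
  have invol: "pair_swap a b (pair_swap a b x) = x" for x
    using pa unfolding pair_swap_def by (smt (verit))
  have range: "pair_swap a b x \<in> {1..2*m}" if "x \<in> {1..2*m}" for x
    using that a b partner_in[OF a] partner_in[OF b] unfolding pair_swap_def by (simp del: atLeastAtMost_iff)
  have p: "pair_swap a b permutes {1..2*m}"
  proof (rule involution_permutes[OF invol range])
    fix x assume "x \<notin> {1..2*m}"
    then show "pair_swap a b x = x"
      using a b partner_in[OF a] partner_in[OF b] unfolding pair_swap_def by metis
  qed
  have comm: "pair_swap a b (partner x) = partner (pair_swap a b x)" if x: "x \<in> {1..2*m}" for x
    using pa inj[OF x a] inj[OF x b] partner_partner[OF x] unfolding pair_swap_def by (smt (verit))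
  have inj': "pair_swap a b x = pair_swap a b y \<longleftrightarrow> x = y" for x y
    using invol by metis
  have "hyperoct m (pair_swap a b i) (pair_swap a b j) = hyperoct m i j"
    if ij: "i \<in> {1..2*m}" "j \<in> {1..2*m}" for i j
    unfolding hyperoct_iff[OF ij] hyperoct_iff[OF range[OF ij(1)] range[OF ij(2)]]
    using comm[OF ij(1), symmetric] inj' by simp
  then show ?thesis using p by (simp add: aut_def)
qed

lemma hyperoct_distance_transitive:
  assumes m: "2 \<le> m"
  shows "distance_transitive_graph (2*m) (hyperoct m) hyperoct_dist 2 hyperoct_rep"
proof -
  have partner_eq: "i = partner j \<longleftrightarrow> j = partner i" if "i \<in> {1..2*m}" "j \<in> {1..2*m}" for i j
    using that partner_partner by metis
  interpret distance_graph "2*m" "hyperoct m" hyperoct_dist 2 hyperoct_rep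
  proof
    fix i j assume ij: "i \<in> {1..2*m}" "j \<in> {1..2*m}"
    show "hyperoct m j i" if "hyperoct m i j" using that by (auto simp: hyperoct_def)
    show "hyperoct_dist i j = hyperoct_dist j i"
      using partner_eq[OF ij] by (auto simp: hyperoct_dist_def)
    show "hyperoct_dist i k \<le> Suc (hyperoct_dist i j)" if k: "k \<in> {1..2*m}" "hyperoct m j k" for k
      using k ij unfolding hyperoct_iff[OF ij(2) k(1)] by (auto simp: hyperoct_dist_def)
    show "\<exists>k\<in>{1..2*m}. hyperoct m k j \<and> hyperoct_dist i k = d" if d: "hyperoct_dist i j = Suc d" for d
    proof (cases "j = partner i")
      case True
      \<comment> \<open>A vertex outside the removed pair of \<open>i\<close>, hence adjacent to
        both of its members.\<close>
      define k where "k = (if i = 1 \<or> i = 2 then 3 else 1 :: nat)"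
      have k: "k \<in> {1..2*m}" "k \<noteq> i" "k \<noteq> partner i"
        using m ij by (auto simp: k_def partner_def)
      then show ?thesis using d True ij hyperoct_iff[OF k(1) ij(2)] partner_eq[OF k(1) ij(2)]
          partner_eq[OF ij(1) k(1)] partner_partner[OF ij(1)]
        by (intro bexI[of _ k]) (auto simp: hyperoct_dist_def split: if_splits)
    next
      case False
      then show ?thesis using d ij hyperoct_iff[OF ij]
        by (intro bexI[of _ i]) (auto simp: hyperoct_dist_def split: if_splits)
    qed
  next
    fix d :: nat assume "d \<le> 2"
    then have "d = 0 \<or> d = 1 \<or> d = 2" by auto
    then show "hyperoct_rep d \<in> {1..2*m}" "hyperoct_dist 1 (hyperoct_rep d) = d"
      using m by (auto simp: hyperoct_rep_def hyperoct_dist_def partner_def)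
  qed (use m in \<open>auto simp: hyperoct_dist_def\<close>)
  show ?thesis
  proof
    fix i j i' j' assume "i \<in> {1..2*m}" "j \<in> {1..2*m}" "i' \<in> {1..2*m}" "j' \<in> {1..2*m}"
      "hyperoct_dist i j = hyperoct_dist i' j'"
    then have "\<exists>\<sigma>\<in>aut (2*m) (hyperoct m). \<sigma> i = i' \<and> \<sigma> j = j'"
    proof (rule transitive_if[rotated 2])
      fix i i' assume "i \<in> {1..2*m}" "i' \<in> {1..2*m}"
      then show "\<exists>\<sigma>\<in>aut (2*m) (hyperoct m). \<sigma> i = i'"
        by (intro bexI[of _ "pair_swap i i'"] pair_swap_in_aut) (simp add: pair_swap_def)
    next
      fix i j j' assume ij: "i \<in> {1..2*m}" "j \<in> {1..2*m}" "j' \<in> {1..2*m}"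
        "hyperoct_dist i j = hyperoct_dist i j'"
      \<comment> \<open>At distance \<open>0\<close> or \<open>2\<close> the vertices
        \<open>j\<close> and \<open>j'\<close> coincide and the swap is the identity; at distance
        \<open>1\<close> the vertex \<open>i\<close> lies outside both of their pairs.\<close>
      have "pair_swap j j' i = i"
        using ij(4) partner_eq[OF ij(1,2)] partner_eq[OF ij(1,3)]
        by (auto simp: pair_swap_def hyperoct_dist_def split: if_splits)
      then show "\<exists>\<sigma>\<in>aut (2*m) (hyperoct m). \<sigma> i = i \<and> \<sigma> j = j'"
        using ij by (intro bexI[of _ "pair_swap j j'"] pair_swap_in_aut) (simp_all add: pair_swap_def)
    qed
    then show "\<exists>\<sigma>\<in>aut (2*m) (hyperoct m). (\<sigma> i = i' \<and> \<sigma> j = j') \<or> (\<sigma> i = j' \<and> \<sigma> j = i')"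
      by blast
  qed
qed

lemma hyperoct_lin_forms:
  assumes m: "2 \<le> m"
  shows "lin_forms (2*m) (hyperoct m) = lspan (hyperoct_gens m)"
proof -
  interpret distance_transitive_graph "2*m" "hyperoct m" hyperoct_dist 2 hyperoct_rep
    by (rule hyperoct_distance_transitive[OF m])
  have 123: "1 \<in> {1..2*m}" "2 \<in> {1..2*m}" "3 \<in> {1..2*m}" using m by auto
  show ?thesis
  proof (rule lin_forms_eq_lspan)
    fix g assume "g \<in> hyperoct_gens m"
    then consider i where "i \<in> {1..2*m}" "g = diff_form 1 1 i i"
      | i j where "hyperoct m i j" "g = diff_form 1 3 i j"
      | i j where "i \<in> {1..2*m}" "j \<in> {1..2*m}" "i \<noteq> j" "\<not> hyperoct m i j" "g = diff_form 1 2 i j"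
      unfolding hyperoct_gens_def by blast
    then show "g \<in> distance_forms"
    proof cases
      case (1 i)
      moreover have "hyperoct_dist 1 1 = hyperoct_dist i i" by (simp add: hyperoct_dist_def)
      ultimately show ?thesis using 123 by (simp only: distance_formsI)
    next
      case (2 i j)
      then have ij: "i \<in> {1..2*m}" "j \<in> {1..2*m}" by (auto simp: hyperoct_def)
      then have "hyperoct_dist 1 3 = hyperoct_dist i j"
        using 2(1) hyperoct_iff[OF ij] by (auto simp: hyperoct_dist_def partner_def[of "Suc 0"])
      then show ?thesis using 123 ij unfolding 2(2) by (intro distance_formsI)
    next
      case (3 i j)
      then have "hyperoct_dist 1 2 = hyperoct_dist i j"
        using hyperoct_iff[OF 3(1,2)] by (auto simp: hyperoct_dist_def partner_def[of "Suc 0"])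
      then show ?thesis using 123 3(1,2) unfolding 3(5) by (intro distance_formsI)
    qed
  next
    fix i j assume ij: "i \<in> {1..2*m}" "j \<in> {1..2*m}"
    have "diff_form 1 (hyperoct_rep (hyperoct_dist i j)) i j \<in> hyperoct_gens m"
    proof (cases "i = j")
      case True
      then show ?thesis using ij by (auto simp: hyperoct_gens_def hyperoct_dist_def hyperoct_rep_def)
    next
      case False
      then show ?thesis using ij hyperoct_iff[OF ij]
        by (cases "j = partner i") (auto simp: hyperoct_gens_def hyperoct_dist_def hyperoct_rep_def)
    qed
    then show "diff_form 1 (hyperoct_rep (hyperoct_dist i j)) i j \<in> lspan (hyperoct_gens m)"
      by (rule lspan_base)
  qed
qed

text \<open>The adjacency matrix is the all-ones matrix minus the identity minus the permutation
  \<open>partner\<close>. Constants give \<open>2m - 2\<close>; among vectors of sum zero, those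
  negated by \<open>partner\<close> give \<open>0\<close> and those fixed by it give
  \<open>-2\<close>.\<close>

lemma hyperoct_eigvals:
  assumes m: "2 \<le> m"
  shows "2 * of_nat m - 2 \<in> eigvals (2*m) (hyperoct m)" "0 \<in> eigvals (2*m) (hyperoct m)"
    "-2 \<in> eigvals (2*m) (hyperoct m)"
proof -
  have row: "(\<Sum>j\<in>{1..2*m}. adj (hyperoct m) i j * v j) = (\<Sum>j\<in>{1..2*m}. v j) - v i - v (partner i)"
    if i: "i \<in> {1..2*m}" for i v
  proof -
    have "partner i \<noteq> i" using i by (auto simp: partner_def)
    then have "(\<Sum>j\<in>{1..2*m}. adj (hyperoct m) i j * v j)
        = (\<Sum>j\<in>{1..2*m}. v j - (if j = i then v j else 0) - (if j = partner i then v j else 0))"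
      using hyperoct_iff[OF i] by (intro sum.cong) (auto simp: adj_def)
    then show ?thesis using i partner_in[OF i] by (simp add: sum_subtractf)
  qed
  have e: "(\<Sum>j\<in>{1..2*m}. if j = a then 1 else 0 :: complex) = 1" if "a \<in> {1,2,3,4}" for a
    using that m by (intro sum_indicator) auto
  show "2 * of_nat m - 2 \<in> eigvals (2*m) (hyperoct m)"
    using row[of _ "\<lambda>_. 1"] m by (intro eigvalsI[of _ _ "\<lambda>_. 1" _ 1]) auto
  show "0 \<in> eigvals (2*m) (hyperoct m)"
  proof (rule eigvalsI)
    let ?v = "\<lambda>j. (if j = 1 then 1 else 0) - (if j = 2 then 1 else 0) :: complex"
    fix i assume i: "i \<in> {1..2*m}"
    have "(\<Sum>j\<in>{1..2*m}. ?v j) = 0" using e[of 1] e[of 2] by (simp only: sum_subtractf) simp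
    moreover have "?v i + ?v (partner i) = 0" using i by (auto simp: partner_def)
    ultimately show "(\<Sum>j\<in>{1..2*m}. adj (hyperoct m) i j * ?v j) = 0 * ?v i"
      unfolding row[OF i, of ?v] by (simp add: algebra_simps)
  next
    show "1 \<in> {1..2*m}" using m by simp
  qed auto
  show "-2 \<in> eigvals (2*m) (hyperoct m)"
  proof (rule eigvalsI)
    let ?v = "\<lambda>j. (if j = 1 then 1 else 0) + (if j = 2 then 1 else 0)
      - (if j = 3 then 1 else 0) - (if j = 4 then 1 else 0) :: complex"
    fix i assume i: "i \<in> {1..2*m}"
    have "(\<Sum>j\<in>{1..2*m}. ?v j) = 0"
      using e[of 1] e[of 2] e[of 3] e[of 4] by (simp only: sum_subtractf sum.distrib) simp
    moreover have "?v (partner i) = ?v i"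
    proof -
      have "partner i = 1 \<longleftrightarrow> i = 2" "partner i = 2 \<longleftrightarrow> i = 1" "partner i = 3 \<longleftrightarrow> i = 4" "partner i = 4 \<longleftrightarrow> i = 3"
        using i unfolding partner_def by (auto; presburger)+
      then show ?thesis by auto
    qed
    ultimately show "(\<Sum>j\<in>{1..2*m}. adj (hyperoct m) i j * ?v j) = -2 * ?v i"
      unfolding row[OF i, of ?v] by simp
  next
    show "1 \<in> {1..2*m}" using m by simp
  qed auto
qed

theorem mainTheorem5:
  shows
  "(\<forall>n\<ge>3. lin_forms n (cycle_graph n) = lspan (sym_forms n (cycle_graph n)) \<and>
      num_eigs n (cycle_graph n) = num_orbits n (cycle_graph n) \<and>
      num_eigs n (cycle_graph n) = n div 2 + 1 \<and>
      lin_forms n (cycle_graph n) = lspan (cycle_gens n))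
 \<and> (\<forall>n\<ge>2. lin_forms n (complete_graph n) = lspan (sym_forms n (complete_graph n)) \<and>
      num_eigs n (complete_graph n) = num_orbits n (complete_graph n) \<and>
      num_eigs n (complete_graph n) = 2 \<and>
      lin_forms n (complete_graph n) = lspan (complete_gens n))
 \<and> (\<forall>m\<ge>2. lin_forms (2*m) (complete_bip m) = lspan (sym_forms (2*m) (complete_bip m)) \<and>
      num_eigs (2*m) (complete_bip m) = num_orbits (2*m) (complete_bip m) \<and>
      num_eigs (2*m) (complete_bip m) = 3 \<and>
      lin_forms (2*m) (complete_bip m) = lspan (bip_gens m))
 \<and> (\<forall>m\<ge>2. lin_forms (2*m) (hyperoct m) = lspan (sym_forms (2*m) (hyperoct m)) \<and>
      num_eigs (2*m) (hyperoct m) = num_orbits (2*m) (hyperoct m) \<and>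
      num_eigs (2*m) (hyperoct m) = 3 \<and>
      lin_forms (2*m) (hyperoct m) = lspan (hyperoct_gens m))"
proof (intro conjI allI impI)
  fix n :: nat assume n: "3 \<le> n"
  interpret distance_transitive_graph n "cycle_graph n" "cycle_dist n" "n div 2" Suc
    by (rule cycle_distance_transitive[OF n])
  show "lin_forms n (cycle_graph n) = lspan (sym_forms n (cycle_graph n))"
    by (rule lin_forms_eq_lspan_sym_forms)
  show r: "num_eigs n (cycle_graph n) = n div 2 + 1"
    by (rule num_eigs_eq[OF cycle_eigvals_inj[OF n] cycle_eigvals[OF n]])
  show "num_eigs n (cycle_graph n) = num_orbits n (cycle_graph n)"
    by (simp only: r num_orbits_eq)
  show "lin_forms n (cycle_graph n) = lspan (cycle_gens n)" by (rule cycle_lin_forms[OF n])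
next
  fix n :: nat assume n: "2 \<le> n"
  interpret distance_transitive_graph n "complete_graph n" "\<lambda>i j. if i = j then 0 else 1" 1 Suc
    by (rule complete_distance_transitive[OF n])
  show "lin_forms n (complete_graph n) = lspan (sym_forms n (complete_graph n))"
    by (rule lin_forms_eq_lspan_sym_forms)
  let ?ev = "\<lambda>d::nat. if d = 0 then of_nat n - 1 else -1 :: complex"
  have "inj_on ?ev {..1}" using n by (auto simp: inj_on_def)
  then have r: "num_eigs n (complete_graph n) = 1 + 1"
    using complete_eigvals[OF n] by (intro num_eigs_eq[of ?ev]) auto
  then show "num_eigs n (complete_graph n) = 2" by simp
  show "num_eigs n (complete_graph n) = num_orbits n (complete_graph n)"
    by (simp only: r num_orbits_eq)
  show "lin_forms n (complete_graph n) = lspan (complete_gens n)" by (rule complete_lin_forms[OF n])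
next
  fix m :: nat assume m: "2 \<le> m"
  interpret distance_transitive_graph "2*m" "complete_bip m" bip_dist 2 Suc
    by (rule bip_distance_transitive[OF m])
  show "lin_forms (2*m) (complete_bip m) = lspan (sym_forms (2*m) (complete_bip m))"
    by (rule lin_forms_eq_lspan_sym_forms)
  let ?ev = "\<lambda>d::nat. if d = 0 then of_nat m else if d = 1 then - of_nat m else 0 :: complex"
  have "inj_on ?ev {..2}" using m by (auto simp: inj_on_def)
  then have r: "num_eigs (2*m) (complete_bip m) = 2 + 1"
    using bip_eigvals[OF m] by (intro num_eigs_eq[of ?ev]) auto
  then show "num_eigs (2*m) (complete_bip m) = 3" by simp
  show "num_eigs (2*m) (complete_bip m) = num_orbits (2*m) (complete_bip m)"
    by (simp only: r num_orbits_eq)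
  show "lin_forms (2*m) (complete_bip m) = lspan (bip_gens m)" by (rule bip_lin_forms[OF m])
next
  fix m :: nat assume m: "2 \<le> m"
  interpret distance_transitive_graph "2*m" "hyperoct m" hyperoct_dist 2 hyperoct_rep
    by (rule hyperoct_distance_transitive[OF m])
  show "lin_forms (2*m) (hyperoct m) = lspan (sym_forms (2*m) (hyperoct m))"
    by (rule lin_forms_eq_lspan_sym_forms)
  let ?ev = "\<lambda>d::nat. if d = 0 then 2 * of_nat m - 2 else if d = 1 then 0 else -2 :: complex"
  have "inj_on ?ev {..2}" using m by (auto simp: inj_on_def)
  then have r: "num_eigs (2*m) (hyperoct m) = 2 + 1"
    using hyperoct_eigvals[OF m] by (intro num_eigs_eq[of ?ev]) auto
  then show "num_eigs (2*m) (hyperoct m) = 3" by simp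
  show "num_eigs (2*m) (hyperoct m) = num_orbits (2*m) (hyperoct m)"
    by (simp only: r num_orbits_eq)
  show "lin_forms (2*m) (hyperoct m) = lspan (hyperoct_gens m)" by (rule hyperoct_lin_forms[OF m])
qed

end
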